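(* There exists an absolute constant $\widehat{C}$ such that for any $\delta$ with $0<\delta<0.001$ there is $K_0=K_0(\delta)$ such that for any integer $K\ge K_0$ and any dictionary $\mathcal{D}=\{\phi_i\}_{i=1}^N$ in $\mathbb{R}^M$ with $\delta^{RIP}_{2K}(\mathcal{D})<\delta$ the following holds. The Orthogonal Matching Pursuit recovers exactly every $K$-sparse signal $\mathbf{x}\in\mathbb{R}^N$ with $\|\mathbf{x}\|_\infty\le1$ within $K+6N(\mathbf{x},\widehat{C}\delta^{1/2}K)$ iterations; in other words, the OMP applied to $f_0=\Phi\mathbf{x}$ has residual $$\mathbf{r}^{K+6N(\mathbf{x},\widehat{C}\delta^{1/2}K)}=0.$$
   Context: A dictionary $\mathcal{D}=\{\phi_i\}_{i=1}^N$ in $\mathbb{R}^M$ ($M<N$) is a set of vectors of unit Euclidean norm whose span is $\mathbb{R}^M$. $\Phi$ denotes the $M\times N$ matrix whose $i$-th column is $\phi_i$. A vector in $\mathbb{R}^N$ is $S$-sparse if it has at most $S$ nonzero coordinates. The isometric constant $\delta^{RIP}_S(\mathcal{D})$ is the minimum of all $\delta$ such that $(1-\delta)\|\mathbf{x}\|^2\le\|\Phi\mathbf{x}\|^2\le(1+\delta)\|\mathbf{x}\|^2$ for all $S$-sparse $\mathbf{x}\in\mathbb{R}^N$ (Euclidean norms). The $K$-sparse signal is taken with support $T=\operatorname{supp}\mathbf{x}$, $|T|=K$. For $\Lambda\subset T$, $\mathbf{x}_\Lambda$ is the restriction of $\mathbf{x}$ to the coordinates in $\Lambda$. For $\nu>0$,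 $N(\mathbf{x},\nu)$ is the minimal integer such that $\|\mathbf{x}_\Lambda\|^2>\nu$ for all $\Lambda\subset T$ with $|\Lambda|\ge N(\mathbf{x},\nu)+1$. Orthogonal Matching Pursuit (OMP): given $f_0$, put $\mathbf{r}^0=f_0$; for each $m\ge1$: (1) choose any $\varphi_m\in\mathcal{D}$ with $|\langle\mathbf{r}^{m-1},\varphi_m\rangle|=\sup_{g\in\mathcal{D}}|\langle\mathbf{r}^{m-1},g\rangle|$; (2) let $G_m$ be the orthogonal projection of $f_0$ onto $\operatorname{span}(\varphi_1,\dots,\varphi_m)$; (3) set $\mathbf{r}^m=f_0-G_m$. Once a residual is $0$, all later residuals are $0$. The statement is for any choice of maximizers. *)

theory Defs
  imports Complex_Main "Jordan_Normal_Form.VS_Connect"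
begin

text \<open>
  The dimensions \<open>M\<close> and \<open>N\<close> are quantified after the constants of the main statement, so they
  cannot be types: vectors and matrices are those of the matrix library with explicit carriers.
  Coordinates and dictionary elements are indexed from \<open>0\<close>.
\<close>

definition vnorm :: "real vec \<Rightarrow> real" where
  "vnorm v = sqrt (v \<bullet> v)"

definition sup_norm :: "real vec \<Rightarrow> real" where
  "sup_norm v = Max ((\<lambda>i. \<bar>v $ i\<bar>) ` {..<dim_vec v})"

definition supp :: "real vec \<Rightarrow> nat set" where
  "supp x = {i. i < dim_vec x \<and> x $ i \<noteq> 0}"

definition sparse :: "nat \<Rightarrow> real vec \<Rightarrow> bool" where
  "sparse S x \<longleftrightarrow> card (supp x) \<le> S"

text \<open>The span of \<open>A\<close> in \<open>\<real>\<^sup>n\<close>; this is \<open>span\<close> of the library locale \<open>vec_space\<close>.\<close>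

abbreviation vspan :: "nat \<Rightarrow> real vec set \<Rightarrow> real vec set" where
  "vspan n A \<equiv> LinearCombinations.module.span class_ring (module_vec TYPE(real) n) A"

definition dictionary :: "nat \<Rightarrow> nat \<Rightarrow> (nat \<Rightarrow> real vec) \<Rightarrow> bool" where
  "dictionary M N \<phi> \<longleftrightarrow> M < N \<and>
     (\<forall>i<N. \<phi> i \<in> carrier_vec M \<and> vnorm (\<phi> i) = 1) \<and>
     vspan M (\<phi> ` {..<N}) = carrier_vec M"

definition dict_mat :: "nat \<Rightarrow> nat \<Rightarrow> (nat \<Rightarrow> real vec) \<Rightarrow> real mat" where
  "dict_mat M N \<phi> = mat_of_cols M (map \<phi> [0..<N])"

text \<open>For a dictionary and \<open>S \<ge> 1\<close> the set of admissible \<open>\<delta>\<close> is nonempty, closed and bounded below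
  by \<open>0\<close>, so the minimum exists.\<close>

definition rip_const :: "nat \<Rightarrow> nat \<Rightarrow> nat \<Rightarrow> (nat \<Rightarrow> real vec) \<Rightarrow> real" where
  "rip_const S M N \<phi> = (LEAST \<delta>. \<forall>x \<in> carrier_vec N. sparse S x \<longrightarrow>
     (1 - \<delta>) * (vnorm x)\<^sup>2 \<le> (vnorm (dict_mat M N \<phi> *\<^sub>v x))\<^sup>2 \<and>
     (vnorm (dict_mat M N \<phi> *\<^sub>v x))\<^sup>2 \<le> (1 + \<delta>) * (vnorm x)\<^sup>2)"

definition restr :: "real vec \<Rightarrow> nat set \<Rightarrow> real vec" where
  "restr x \<Lambda> = vec (dim_vec x) (\<lambda>i. if i \<in> \<Lambda> then x $ i else 0)"

text \<open>For \<open>\<nu> > 0\<close> the minimum over the integers is a natural number, because a negative integer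
  would admit \<open>\<Lambda> = {}\<close>. The condition holds vacuously at \<open>n = card (supp x)\<close>.\<close>

definition N_count :: "real vec \<Rightarrow> real \<Rightarrow> nat" where
  "N_count x \<nu> = (LEAST n. \<forall>\<Lambda> \<subseteq> supp x. card \<Lambda> \<ge> n + 1 \<longrightarrow> (vnorm (restr x \<Lambda>))\<^sup>2 > \<nu>)"

definition is_orth_proj :: "nat \<Rightarrow> real vec set \<Rightarrow> real vec \<Rightarrow> real vec \<Rightarrow> bool" where
  "is_orth_proj n V f g \<longleftrightarrow> g \<in> V \<and> (\<forall>v \<in> V. (f - g) \<bullet> v = 0)"

text \<open>\<open>omp M D f\<^sub>0 \<psi> r\<close>: choosing \<open>\<psi> m\<close> in step \<open>m \<ge> 1\<close> (\<open>\<psi> 0\<close> is unused) is a run of Orthogonal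
  Matching Pursuit in \<open>\<real>\<^sup>M\<close> on input \<open>f\<^sub>0\<close>, with residuals \<open>r m\<close>. A run goes on after the residual
  vanishes: every element of \<open>D\<close> is then a maximizer and the residual stays \<open>0\<close>.\<close>

definition omp ::
  "nat \<Rightarrow> real vec set \<Rightarrow> real vec \<Rightarrow> (nat \<Rightarrow> real vec) \<Rightarrow> (nat \<Rightarrow> real vec) \<Rightarrow> bool" where
  "omp M D f\<^sub>0 \<psi> r \<longleftrightarrow> r 0 = f\<^sub>0 \<and>
     (\<forall>m\<ge>1. \<psi> m \<in> D \<and>
        \<bar>r (m - 1) \<bullet> \<psi> m\<bar> = (SUP g\<in>D. \<bar>r (m - 1) \<bullet> g\<bar>) \<and>
        (\<exists>G. is_orth_proj M (vspan M (\<psi> ` {1..m})) f\<^sub>0 G \<and> r m = f\<^sub>0 - G))"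

end

theory Submission
  imports Defs
begin

text \<open>
  Write \<open>\<Gamma>\<close> for the part of the support of \<open>x\<close> that has not been selected yet. By the RIP the squared
  residual differs from \<open>\<parallel>x\<^sub>\<Gamma>\<parallel>\<^sup>2\<close> by at most \<open>\<delta>K\<close>, and each step lowers it by at least \<open>g\<^sup>2\<close>, where \<open>g\<close> is the
  largest correlation with the dictionary. On \<open>\<Gamma>\<close> the correlations are \<open>l\<^sup>2\<close>-close to \<open>x\<close>, so almost no
  coordinate on \<open>\<Gamma>\<close> exceeds \<open>g\<close> substantially. Measured in
  units of the smallest \<open>g\<^sup>2\<close> so far, every step uses up at least one unit of the squared residual, while
  \<open>\<parallel>x\<^sub>\<Gamma>\<parallel>\<^sup>2\<close> is lowered only by steps inside the support, by about one unit at most; as long as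
  \<open>\<parallel>x\<^sub>\<Gamma>\<parallel>\<^sup>2 > 10 \<delta>\<^sup>1\<^sup>/\<^sup>2 K\<close>, this leaves at most \<open>7 \<delta>\<^sup>1\<^sup>/\<^sup>2 K\<close> wrong steps among the first \<open>|supp x|\<close>. Since
  \<open>\<parallel>x\<parallel>\<^sub>\<infinity> \<le> 1\<close>, it follows that \<open>|\<Gamma>| \<le> N(x, 10 \<delta>\<^sup>1\<^sup>/\<^sup>2 K)\<close> after \<open>K\<close> steps.

  From then on \<open>6 |\<Gamma>|\<close> further steps suffice, as in Zhang's theorem: rounds of \<open>1, 3, 7, \<dots>\<close> steps, each
  compared with the tail of \<open>x\<^sub>\<Gamma>\<close> beyond its \<open>1, 3, 7, \<dots>\<close> largest entries, reduce \<open>|\<Gamma>|\<close> by a fixed fraction of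
  the number of steps. The RIP of the larger order needed here follows from the order \<open>2K\<close> by splitting
  vectors into blocks of size \<open>K\<close>.
\<close>

section \<open>Quadratic forms and restricted isometry on coefficients\<close>

locale gram_form =
  fixes N :: nat and a :: "nat \<Rightarrow> nat \<Rightarrow> real"
  assumes sym: "i < N \<Longrightarrow> j < N \<Longrightarrow> a i j = a j i"
    and psd: "0 \<le> (\<Sum>i<N. \<Sum>j<N. y i * (a i j * y j))"
begin

text \<open>When \<open>a\<close> is the Gram matrix of the dictionary, this is the inner product of
  its \<open>i\<close>-th element with the vector that has coefficients \<open>y\<close>;
  \<open>form\<close> is then the inner product of two such vectors.\<close>

definition corr :: "(nat \<Rightarrow> real) \<Rightarrow> nat \<Rightarrow> real" where
  "corr y i = (\<Sum>j<N. a i j * y j)"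

definition form :: "(nat \<Rightarrow> real) \<Rightarrow> (nat \<Rightarrow> real) \<Rightarrow> real" where
  "form y w = (\<Sum>i<N. y i * corr w i)"

definition nsq :: "(nat \<Rightarrow> real) \<Rightarrow> real" where
  "nsq y = (\<Sum>i<N. (y i)\<^sup>2)"

definition rip :: "nat \<Rightarrow> real \<Rightarrow> bool" where
  "rip n d \<longleftrightarrow> (\<forall>y. card {i. i < N \<and> y i \<noteq> 0} \<le> n \<longrightarrow> \<bar>form y y - nsq y\<bar> \<le> d * nsq y)"

lemma form_nonneg: "0 \<le> form y y"
  using psd[of y] by (simp add: form_def corr_def sum_distrib_left)

lemma nsq_nonneg: "0 \<le> nsq y"
  by (simp add: nsq_def sum_nonneg)

lemma form_sym: "form y w = form w y"
proof -
  have "form y w = (\<Sum>i<N. \<Sum>j<N. y i * (a i j * w j))"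
    by (simp add: form_def corr_def sum_distrib_left)
  also have "\<dots> = (\<Sum>j<N. \<Sum>i<N. y i * (a i j * w j))"
    by (rule sum.swap)
  also have "\<dots> = form w y"
    unfolding form_def corr_def sum_distrib_left
    by (intro sum.cong refl) (simp add: sym mult_ac)
  finally show ?thesis .
qed

lemma form_add_left: "form (\<lambda>i. y i + l * w i) v = form y v + l * form w v"
  by (simp add: form_def ring_distribs sum.distrib sum_distrib_left mult_ac)

lemma form_sum_left: "form (\<lambda>i. \<Sum>b\<in>B. y b i) v = (\<Sum>b\<in>B. form (y b) v)"
  unfolding form_def sum_distrib_right by (rule sum.swap)

lemma form_add:
  "form (\<lambda>i. y i + l * w i) (\<lambda>i. y i + l * w i) = form y y + 2 * l * form y w + l\<^sup>2 * form w w"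
proof -
  have "form v (\<lambda>i. y i + l * w i) = form y v + l * form w v" for v
    by (subst form_sym) (rule form_add_left)
  then show ?thesis
    unfolding form_add_left by (simp add: form_sym[of w y] algebra_simps power2_eq_square)
qed

lemma nsq_add:
  "nsq (\<lambda>i. y i + l * w i) = nsq y + 2 * l * (\<Sum>i<N. y i * w i) + l\<^sup>2 * nsq w"
  by (simp add: nsq_def power2_sum power_mult_distrib sum.distrib sum_distrib_left mult_ac)

text \<open>Pythagoras: \<open>y - z\<close> lives where the correlations of \<open>z\<close>
  vanish, so it is orthogonal to \<open>z\<close>. This is the least-squares optimality of a
  residual.\<close>

lemma form_le_if_orthogonal:
  assumes "\<And>i. i < N \<Longrightarrow> y i \<noteq> z i \<Longrightarrow> corr z i = 0"
  shows "form z z \<le> form y y"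
proof -
  define v where "v i = y i - z i" for i
  have "form v z = 0"
    unfolding form_def using assms by (intro sum.neutral) (auto simp: v_def)
  moreover have "form y y = form (\<lambda>i. z i + 1 * v i) (\<lambda>i. z i + 1 * v i)"
    by (simp add: v_def)
  ultimately show ?thesis
    using form_nonneg[of v] form_add[of z 1 v] by (simp add: form_sym[of z v])
qed

text \<open>A crude bound that provides the existence of some isometry constant in
  \<open>rip_Least\<close>.\<close>

lemma form_le_nsq: "form y y \<le> (\<Sum>i<N. \<Sum>j<N. \<bar>a i j\<bar>) * nsq y"
proof -
  have y: "(y i)\<^sup>2 \<le> nsq y" if "i < N" for i
    unfolding nsq_def using that by (intro member_le_sum) auto
  have "form y y = (\<Sum>i<N. \<Sum>j<N. a i j * (y i * y j))"
    by (simp add: form_def corr_def sum_distrib_left mult_ac)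
  also have "\<dots> \<le> (\<Sum>i<N. \<Sum>j<N. \<bar>a i j\<bar> * nsq y)"
  proof (intro sum_mono)
    fix i j assume ij: "i \<in> {..<N}" "j \<in> {..<N}"
    have "2 * \<bar>y i * y j\<bar> \<le> (y i)\<^sup>2 + (y j)\<^sup>2"
      using sum_squares_bound[of "\<bar>y i\<bar>" "\<bar>y j\<bar>"] by (simp add: abs_mult)
    also have "\<dots> \<le> 2 * nsq y" using y[of i] y[of j] ij by simp
    finally have "\<bar>a i j\<bar> * \<bar>y i * y j\<bar> \<le> \<bar>a i j\<bar> * nsq y"
      by (intro mult_left_mono) auto
    then show "a i j * (y i * y j) \<le> \<bar>a i j\<bar> * nsq y"
      using abs_ge_self[of "a i j * (y i * y j)"] by (simp add: abs_mult)
  qed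
  finally show ?thesis by (simp add: sum_distrib_right)
qed

text \<open>\<open>LEAST\<close> over the reals carries information only if the minimum is attained.
  The admissible constants form a nonempty closed set, and a unit coordinate vector, available by
  \<open>0 < n\<close> and \<open>i < N\<close>, shows that none of them is negative.\<close>

lemma rip_Least:
  assumes "0 < n" "i < N"
  shows "rip n (LEAST d. rip n d)"
proof -
  define Z where "Z = {d. rip n d}"
  have "\<bar>form y y - nsq y\<bar> \<le> ((\<Sum>i<N. \<Sum>j<N. \<bar>a i j\<bar>) + 1) * nsq y" for y
    using form_le_nsq[of y] form_nonneg[of y] nsq_nonneg[of y]
      mult_nonneg_nonneg[OF _ nsq_nonneg[of y], of "\<Sum>i<N. \<Sum>j<N. \<bar>a i j\<bar>"]
    by (auto simp: abs_le_iff algebra_simps sum_nonneg)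
  then have ne: "Z \<noteq> {}" unfolding Z_def rip_def by blast
  have bdd: "0 \<le> d" if "d \<in> Z" for d
  proof -
    let ?y = "\<lambda>j. if j = i then 1 else 0 :: real"
    have "{j. j < N \<and> ?y j \<noteq> 0} = {i}" using assms by auto
    then have "\<bar>form ?y ?y - nsq ?y\<bar> \<le> d * nsq ?y"
      using that assms(1) unfolding Z_def rip_def by auto
    moreover have "nsq ?y = 1"
      using assms by (simp add: nsq_def if_distrib[of "\<lambda>x. x\<^sup>2"] cong: if_cong)
    ultimately show ?thesis by (metis abs_ge_zero mult.right_neutral order.trans)
  qed
  have "bdd_below Z" using bdd by (rule bdd_belowI)
  have "rip n (Inf Z)"
    unfolding rip_def
  proof (intro allI impI)
    fix y :: "nat \<Rightarrow> real"
    assume y: "card {i. i < N \<and> y i \<noteq> 0} \<le> n"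
    have le: "\<bar>form y y - nsq y\<bar> \<le> d * nsq y" if "d \<in> Z" for d
      using that y unfolding Z_def rip_def by blast
    show "\<bar>form y y - nsq y\<bar> \<le> Inf Z * nsq y"
    proof (cases "nsq y = 0")
      case True
      then show ?thesis using ne le by auto
    next
      case False
      then have pos: "0 < nsq y" using nsq_nonneg[of y] by simp
      then have "\<bar>form y y - nsq y\<bar> / nsq y \<le> Inf Z"
        using ne le by (intro cInf_greatest) (auto simp: divide_le_eq)
      then show ?thesis using pos by (simp add: divide_le_eq)
    qed
  qed
  moreover have "(LEAST d. rip n d) = Inf Z"
    using \<open>rip n (Inf Z)\<close> \<open>bdd_below Z\<close> by (intro Least_equality cInf_lower) (auto simp: Z_def)
  ultimately show ?thesis by simp
qed

lemma rip_mono: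
  assumes "rip n d" "d \<le> d'"
  shows "rip n d'"
  using assms nsq_nonneg unfolding rip_def by (meson mult_right_mono order.trans)

lemma ripD:
  assumes "rip n d" "F \<subseteq> {..<N}" "card F \<le> n" "\<And>i. i < N \<Longrightarrow> i \<notin> F \<Longrightarrow> y i = 0"
  shows "(1 - d) * nsq y \<le> form y y" "form y y \<le> (1 + d) * nsq y"
proof -
  have "finite F"
    using assms(2) finite_subset by blast
  then have "card {i. i < N \<and> y i \<noteq> 0} \<le> n"
    using assms(4) by (intro order.trans[OF _ assms(3)] card_mono) auto
  then have "\<bar>form y y - nsq y\<bar> \<le> d * nsq y"
    using assms(1) unfolding rip_def by blast
  then show "(1 - d) * nsq y \<le> form y y" "form y y \<le> (1 + d) * nsq y"
    by (simp_all add: algebra_simps abs_le_iff)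
qed

text \<open>Subtract the lower bound at \<open>y - l * w\<close> from the upper bound at
  \<open>y + l * w\<close>. The scale \<open>l\<close> stays free: \<open>1\<close> and
  \<open>-1\<close> give both signs in \<open>rip_mult\<close>, and \<open>1 / d\<close> gives an l2
  bound on correlations in \<open>card_rest_le\<close>.\<close>

lemma rip_polarization:
  assumes "rip n d" "F \<subseteq> {..<N}" "card F \<le> n"
    and y: "\<And>i. i < N \<Longrightarrow> i \<notin> F \<Longrightarrow> y i = 0" and w: "\<And>i. i < N \<Longrightarrow> i \<notin> F \<Longrightarrow> w i = 0"
  shows "2 * l * (form y w - (\<Sum>i<N. y i * w i)) \<le> d * (nsq y + l\<^sup>2 * nsq w)"
proof -
  have "form (\<lambda>i. y i + l * w i) (\<lambda>i. y i + l * w i) \<le> (1 + d) * nsq (\<lambda>i. y i + l * w i)"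
    using assms(1-3) y w by (intro ripD) auto
  moreover have "(1 - d) * nsq (\<lambda>i. y i + (-l) * w i)
      \<le> form (\<lambda>i. y i + (-l) * w i) (\<lambda>i. y i + (-l) * w i)"
    using assms(1-3) y w by (intro ripD) auto
  ultimately show ?thesis
    unfolding form_add nsq_add by (simp add: algebra_simps)
qed

text \<open>Cut the support into \<open>p\<close> blocks of at most \<open>n\<close> indices. Two
  blocks together have at most \<open>2 * n\<close> indices, so polarization controls every pair;
  each block is counted \<open>2 * p\<close> times with weight \<open>d / 2\<close>, whence the
  factor \<open>p * d\<close>.\<close>

lemma rip_mult:
  assumes "rip (2 * n) d" "n > 0"
  shows "rip (p * n) (p * d)"
  unfolding rip_def
proof (intro allI impI)
  fix y :: "nat \<Rightarrow> real"
  define F where "F = {i. i < N \<and> y i \<noteq> 0}"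
  assume "card {i. i < N \<and> y i \<noteq> 0} \<le> p * n"
  then have cF: "card F \<le> p * n" by (simp add: F_def)
  have "finite F" by (simp add: F_def)
  then obtain h where h: "bij_betw h F {0..<card F}"
    using ex_bij_betw_finite_nat by blast
  define blk where "blk i = h i div n" for i
  have blk_less: "blk i < p" if "i \<in> F" for i
  proof -
    have "h i < card F" using h that by (auto dest: bij_betwE)
    then show ?thesis using cF \<open>n > 0\<close> by (simp add: blk_def div_less_iff_less_mult)
  qed
  have card_blk: "card {i \<in> F. blk i = b} \<le> n" for b
  proof -
    have "card {i \<in> F. blk i = b} = card (h ` {i \<in> F. blk i = b})"
      using h by (intro card_image[symmetric]) (auto simp: bij_betw_def inj_on_def)
    also have "\<dots> \<le> card {b * n..<b * n + n}"
    proof (intro card_mono)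
      show "h ` {i \<in> F. blk i = b} \<subseteq> {b * n..<b * n + n}"
        using \<open>n > 0\<close> by (auto simp: blk_def dividend_less_times_div) (metis add.commute dividend_less_div_times)
    qed simp
    finally show ?thesis by simp
  qed
  define u where "u b i = (if i \<in> F \<and> blk i = b then y i else 0)" for b i
  have y_eq: "y i = (\<Sum>b<p. u b i)" if "i < N" for i
    using blk_less[of i] that by (cases "y i = 0") (auto simp: u_def F_def)
  have nsq_u: "(\<Sum>b<p. nsq (u b)) = nsq y"
  proof -
    have "(\<Sum>b<p. nsq (u b)) = (\<Sum>i<N. \<Sum>b<p. (u b i)\<^sup>2)"
      unfolding nsq_def by (rule sum.swap)
    also have "\<dots> = nsq y"
      unfolding nsq_def
    proof (intro sum.cong refl)
      fix i assume "i \<in> {..<N}"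
      then show "(\<Sum>b<p. (u b i)\<^sup>2) = (y i)\<^sup>2"
        using blk_less[of i] by (cases "y i = 0") (auto simp: u_def F_def if_distrib[of "\<lambda>x. x\<^sup>2"] cong: if_cong)
    qed
    finally show ?thesis .
  qed
  let ?ip = "\<lambda>v w. \<Sum>i<N. v i * w i"
  have cong: "form y y = form (\<lambda>i. \<Sum>b<p. u b i) (\<lambda>i. \<Sum>b<p. u b i)"
    unfolding form_def corr_def by (intro sum.cong refl arg_cong2[of _ _ _ _ "(*)"]) (auto simp: y_eq)
  have form_y: "form y y = (\<Sum>b<p. \<Sum>c<p. form (u b) (u c))"
    unfolding cong form_sum_left form_sym[of "u _" "\<lambda>i. \<Sum>b<p. u b i"] by (subst sum.swap) (rule refl)
  have nsq_y: "nsq y = (\<Sum>b<p. \<Sum>c<p. ?ip (u b) (u c))"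
  proof -
    have "nsq y = (\<Sum>i<N. (\<Sum>b<p. u b i) * (\<Sum>c<p. u c i))"
      unfolding nsq_def by (intro sum.cong refl) (auto simp: power2_eq_square y_eq)
    also have "\<dots> = (\<Sum>i<N. \<Sum>b<p. \<Sum>c<p. u b i * u c i)"
      by (simp add: sum_product)
    also have "\<dots> = (\<Sum>b<p. \<Sum>i<N. \<Sum>c<p. u b i * u c i)"
      by (rule sum.swap)
    also have "\<dots> = (\<Sum>b<p. \<Sum>c<p. ?ip (u b) (u c))"
      by (intro sum.cong refl sum.swap)
    finally show ?thesis .
  qed
  have pair: "\<bar>form (u b) (u c) - ?ip (u b) (u c)\<bar> \<le> d / 2 * (nsq (u b) + nsq (u c))" for b c
  proof -
    define G where "G = {i \<in> F. blk i = b} \<union> {i \<in> F. blk i = c}"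
    have G: "G \<subseteq> {..<N}" "card G \<le> 2 * n"
      using card_Un_le[of "{i \<in> F. blk i = b}" "{i \<in> F. blk i = c}"] card_blk[of b] card_blk[of c]
      by (auto simp: G_def F_def)
    have "2 * l * (form (u b) (u c) - ?ip (u b) (u c)) \<le> d * (nsq (u b) + l\<^sup>2 * nsq (u c))" for l
      using assms(1) G by (intro rip_polarization[where F = G]) (auto simp: u_def G_def)
    from this[of 1] this[of "-1"] show ?thesis by (auto simp: abs_if)
  qed
  have "\<bar>form y y - nsq y\<bar> = \<bar>\<Sum>b<p. \<Sum>c<p. form (u b) (u c) - ?ip (u b) (u c)\<bar>"
    by (simp add: form_y nsq_y sum_subtractf)
  also have "\<dots> \<le> (\<Sum>b<p. \<Sum>c<p. \<bar>form (u b) (u c) - ?ip (u b) (u c)\<bar>)"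
    by (intro order.trans[OF sum_abs] sum_mono) auto
  also have "\<dots> \<le> (\<Sum>b<p. \<Sum>c<p. d / 2 * (nsq (u b) + nsq (u c)))"
    by (intro sum_mono pair)
  also have "\<dots> = d / 2 * (\<Sum>b<p. \<Sum>c<p. nsq (u b) + nsq (u c))"
    by (simp only: sum_distrib_left)
  also have "(\<Sum>b<p. \<Sum>c<p. nsq (u b) + nsq (u c)) = 2 * p * nsq y"
    by (simp add: sum.distrib nsq_u flip: sum_distrib_left)
  also have "d / 2 * (2 * p * nsq y) = p * d * nsq y"
    by simp
  finally show "\<bar>form y y - nsq y\<bar> \<le> p * d * nsq y" .
qed

end

section \<open>OMP runs in terms of coefficients\<close>

text \<open>\<open>z t\<close> are coefficients of the residual after \<open>t\<close> steps, and \<open>S t\<close> are the indices selected by then.\<close>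

locale omp_coefficients = gram_form +
  fixes x :: "nat \<Rightarrow> real" and z :: "nat \<Rightarrow> nat \<Rightarrow> real" and S :: "nat \<Rightarrow> nat set"
  assumes S_0: "S 0 = {}"
    and S_Suc: "S t \<subseteq> S (Suc t)"
    and S_subset: "S t \<subseteq> {..<N}"
    and card_S: "card (S t) \<le> t"
    and z_eq: "i < N \<Longrightarrow> i \<notin> S t \<Longrightarrow> z t i = x i"
    and orth: "i \<in> S t \<Longrightarrow> corr (z t) i = 0"
    and decrease: "i < N \<Longrightarrow>
      form (z (Suc t)) (z (Suc t)) \<le> form (z t) (z t) - (corr (z t) i)\<^sup>2"
begin

definition T :: "nat set" where
  "T = {i. i < N \<and> x i \<noteq> 0}"

definition rest :: "nat \<Rightarrow> nat set" where
  "rest t = T - S t"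

definition energy :: "nat set \<Rightarrow> real" where
  "energy A = (\<Sum>i\<in>A. (x i)\<^sup>2)"

text \<open>The squared norm of the residual after \<open>t\<close> steps.\<close>

definition D :: "nat \<Rightarrow> real" where
  "D t = form (z t) (z t)"

definition keep :: "nat set \<Rightarrow> nat \<Rightarrow> real" where
  "keep A i = (if i \<in> A then x i else 0)"

lemma finite_T [simp]: "finite T"
  by (simp add: T_def)

lemma finite_rest [simp]: "finite (rest t)"
  by (simp add: rest_def)

lemma T_subset: "T \<subseteq> {..<N}"
  by (auto simp: T_def)

lemma rest_subset: "rest t \<subseteq> T" "rest t \<subseteq> {..<N}"
  by (auto simp: rest_def T_def)

lemma S_mono: "t \<le> t' \<Longrightarrow> S t \<subseteq> S t'"
  using S_Suc by (rule lift_Suc_mono_le)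

lemma finite_S [simp]: "finite (S t)"
  using S_subset finite_subset by blast

lemma rest_antimono: "t \<le> t' \<Longrightarrow> rest t' \<subseteq> rest t"
  using S_mono by (auto simp: rest_def)

lemma card_S_Un_T: "card (S t \<union> T) \<le> t + card T"
  using card_Un_le[of "S t" T] card_S[of t] by linarith

lemma energy_nonneg: "0 \<le> energy A"
  by (simp add: energy_def sum_nonneg)

lemma energy_mono: "A \<subseteq> B \<Longrightarrow> B \<subseteq> T \<Longrightarrow> energy A \<le> energy B"
  unfolding energy_def by (intro sum_mono2 finite_subset[of B T]) auto

lemma energy_pos: "A \<subseteq> T \<Longrightarrow> A \<noteq> {} \<Longrightarrow> 0 < energy A"
  unfolding energy_def by (intro sum_pos finite_subset[of A T]) (auto simp: T_def)

lemma nsq_keep: "A \<subseteq> {..<N} \<Longrightarrow> nsq (keep A) = energy A"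
  unfolding nsq_def energy_def keep_def
  by (intro sum.mono_neutral_cong_right) auto

lemma D_nonneg: "0 \<le> D t"
  by (simp add: D_def form_nonneg)

text \<open>Packs the greedy choice into one number, the largest correlation. \<open>N = 0\<close>
  is separate because \<open>Max\<close> of the empty set is unspecified.\<close>

lemma greedy:
  obtains g where "0 \<le> g" "\<And>i. i < N \<Longrightarrow> \<bar>corr (z t) i\<bar> \<le> g" "D (Suc t) \<le> D t - g\<^sup>2"
proof (cases "N = 0")
  case True
  then have "D (Suc t) \<le> D t - 0\<^sup>2"
    unfolding D_def form_def by simp
  then show ?thesis
    using True by (intro that[of 0]) auto
next
  case False
  define g where "g = Max ((\<lambda>i. \<bar>corr (z t) i\<bar>) ` {..<N})"
  have le: "\<bar>corr (z t) i\<bar> \<le> g" if "i < N" for i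
    unfolding g_def using that by (intro Max_ge) auto
  have "g \<in> (\<lambda>i. \<bar>corr (z t) i\<bar>) ` {..<N}"
    unfolding g_def using False by (intro Max_in) auto
  then obtain i where "i < N" "g = \<bar>corr (z t) i\<bar>" by auto
  then show ?thesis
    using le decrease[of i t] by (intro that[of g]) (auto simp: D_def)
qed

lemma D_antimono: "t \<le> t' \<Longrightarrow> D t' \<le> D t"
proof (rule lift_Suc_antimono_le[of D])
  show "D (Suc t) \<le> D t" for t
    by (rule greedy[of t]) (smt (verit) zero_le_power2)
qed

text \<open>The selected coefficients are optimal, so changing them at will gives a competitor that
  is no better.\<close>

lemma D_le_form:
  assumes "\<And>i. i < N \<Longrightarrow> i \<notin> S t \<Longrightarrow> y i = x i"
  shows "D t \<le> form y y"
  unfolding D_def using assms z_eq[of _ t] orth[of _ t] by (intro form_le_if_orthogonal) metis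

lemma energy_rest_le_nsq: "energy (rest t) \<le> nsq (z t)"
proof -
  have "energy (rest t) = (\<Sum>i\<in>rest t. (z t i)\<^sup>2)"
    unfolding energy_def using z_eq[of _ t] rest_subset[of t] by (intro sum.cong) (auto simp: rest_def)
  also have "\<dots> \<le> nsq (z t)"
    unfolding nsq_def using rest_subset by (intro sum_mono2) auto
  finally show ?thesis .
qed

section \<open>Decay of the residual under restricted isometry\<close>

context
  fixes n :: nat and c :: real
  assumes rip: "rip n c"
begin

text \<open>The competitor sets all selected coefficients to zero and keeps \<open>x\<close> on the
  unselected support.\<close>

lemma D_upper:
  assumes "card (rest t) \<le> n"
  shows "D t \<le> (1 + c) * energy (rest t)"
proof -
  have "D t \<le> form (keep (rest t)) (keep (rest t))"
    by (rule D_le_form) (auto simp: keep_def rest_def T_def)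
  also have "\<dots> \<le> (1 + c) * nsq (keep (rest t))"
    using assms rest_subset rip by (intro ripD[of n c "rest t"]) (auto simp: keep_def)
  finally show ?thesis by (simp add: nsq_keep rest_subset)
qed

lemma D_lower_nsq:
  assumes "card (S t \<union> T) \<le> n"
  shows "(1 - c) * nsq (z t) \<le> D t"
  unfolding D_def using assms rip S_subset T_subset z_eq[of _ t]
  by (intro ripD[of n c "S t \<union> T"]) (auto simp: T_def)

lemma D_lower:
  assumes "card (S t \<union> T) \<le> n" "c \<le> 1"
  shows "(1 - c) * energy (rest t) \<le> D t"
  using mult_left_mono[OF energy_rest_le_nsq[of t], of "1 - c"] D_lower_nsq[OF assms(1)] assms(2)
  by linarith

text \<open>If the squared residual exceeds the level that \<Lambda> alone accounts for, the excess
  is seen by the at most \<open>u\<close> remaining indices outside \<Lambda>. By averaging, the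
  largest squared correlation is at least the fraction \<open>(1 - c) / u\<close> of the
  excess.\<close>

lemma D_Suc_le:
  assumes L: "\<Lambda> \<subseteq> T" and u: "card (rest t - \<Lambda>) \<le> u" "u > 0"
    and n: "card (S t \<union> T) \<le> n" and c: "0 \<le> c" "c < 1"
  shows "D (Suc t) \<le> D t - (1 - c) / u * (D t - (1 + c) * energy \<Lambda>)"
proof -
  obtain g where g: "0 \<le> g" "\<And>i. i < N \<Longrightarrow> \<bar>corr (z t) i\<bar> \<le> g" "D (Suc t) \<le> D t - g\<^sup>2"
    using greedy[of t] by blast
  define U where "U = rest t - \<Lambda>"
  \<comment> \<open>The part of \<open>x\<close> to be given up. Taking it away from
    \<open>z t\<close> leaves \<open>y\<close>, equal to \<open>x\<close> on \<open>U\<close> and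
    otherwise supported in \<open>S t\<close>, where the correlations vanish.\<close>
  define w where "w = keep (rest t \<inter> \<Lambda>)"
  define y where "y i = z t i + (-1) * w i" for i
  have U: "finite U" "U \<subseteq> {..<N}" "card U \<le> u"
    using u rest_subset by (auto simp: U_def)
  have y_U: "y i = x i" if "i \<in> U" for i
    using that z_eq[of i t] rest_subset by (auto simp: y_def w_def keep_def U_def rest_def T_def)
  have y_0: "y i = 0" if "i < N" "i \<notin> S t" "i \<notin> U" for i
    using that z_eq[of i t] by (auto simp: y_def w_def keep_def U_def rest_def T_def)
  have "form y (z t) = (\<Sum>i\<in>U. x i * corr (z t) i)"
    unfolding form_def using U y_U y_0 orth[of _ t]
    by (intro sum.mono_neutral_cong_right) (auto intro: sum.mono_neutral_cong_right)
  have "form w w \<le> (1 + c) * nsq w"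
  proof (rule ripD(2)[OF rip])
    show "rest t \<inter> \<Lambda> \<subseteq> {..<N}" using rest_subset by blast
    have "card (rest t \<inter> \<Lambda>) \<le> card (S t \<union> T)"
      using rest_subset[of t] by (intro card_mono) auto
    then show "card (rest t \<inter> \<Lambda>) \<le> n" using n by simp
  qed (auto simp: w_def keep_def)
  also have "nsq w = energy (rest t \<inter> \<Lambda>)"
    unfolding w_def using rest_subset by (intro nsq_keep) blast
  also have "(1 + c) * \<dots> \<le> (1 + c) * energy \<Lambda>"
    using c L by (intro mult_left_mono energy_mono) auto
  finally have w: "form w w \<le> (1 + c) * energy \<Lambda>" .
  have w_eq: "w = (\<lambda>i. z t i + (-1) * y i)" by (simp add: y_def)
  have ww: "form w w = D t - 2 * form y (z t) + form y y"
    unfolding D_def by (subst (1 2) w_eq, subst form_add) (simp add: form_sym)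
  have "(1 - c) * energy U \<le> (1 - c) * nsq y"
  proof -
    have "energy U = (\<Sum>i\<in>U. (y i)\<^sup>2)"
      unfolding energy_def using y_U by simp
    also have "\<dots> \<le> nsq y"
      unfolding nsq_def using U by (intro sum_mono2) auto
    finally show ?thesis using c by (intro mult_left_mono) auto
  qed
  also have "\<dots> \<le> form y y"
  proof (rule ripD(1)[OF rip _ n])
    show "S t \<union> T \<subseteq> {..<N}" using S_subset T_subset by blast
    show "y i = 0" if "i < N" "i \<notin> S t \<union> T" for i
      using that rest_subset(1)[of t] by (intro y_0) (auto simp: U_def)
  qed
  finally have yy: "(1 - c) * energy U \<le> form y y" .
  \<comment> \<open>Weighted AM-GM, with the weight chosen such that the squares of
    \<open>x i\<close> sum to \<open>(1 - c) * energy U\<close> and are absorbed by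
    \<open>form y y\<close>.\<close>
  have "2 * form y (z t) = (\<Sum>i\<in>U. 2 * x i * corr (z t) i)"
    by (simp add: \<open>form y (z t) = _\<close> sum_distrib_left mult_ac)
  also have "\<dots> \<le> (\<Sum>i\<in>U. (1 - c) * (x i)\<^sup>2 + g\<^sup>2 / (1 - c))"
  proof (rule sum_mono)
    fix i assume "i \<in> U"
    have "0 \<le> ((1 - c) * x i - corr (z t) i)\<^sup>2" by simp
    then have "2 * x i * corr (z t) i * (1 - c) \<le> ((1 - c) * x i)\<^sup>2 + (corr (z t) i)\<^sup>2"
      by (simp add: power2_eq_square algebra_simps)
    also have "(corr (z t) i)\<^sup>2 \<le> g\<^sup>2"
      using g(1) g(2)[of i] \<open>i \<in> U\<close> U by (intro abs_le_square_iff[THEN iffD1]) auto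
    finally show "2 * x i * corr (z t) i \<le> (1 - c) * (x i)\<^sup>2 + g\<^sup>2 / (1 - c)"
      using c by (simp add: field_simps power2_eq_square)
  qed
  also have "\<dots> = (1 - c) * energy U + card U * (g\<^sup>2 / (1 - c))"
    by (simp add: sum.distrib energy_def sum_distrib_left)
  also have "\<dots> \<le> form y y + u * (g\<^sup>2 / (1 - c))"
    using yy U c by (intro add_mono mult_right_mono) auto
  finally have "D t - (1 + c) * energy \<Lambda> \<le> u * (g\<^sup>2 / (1 - c))"
    using w ww by linarith
  then have "(1 - c) / u * (D t - (1 + c) * energy \<Lambda>) \<le> (1 - c) / u * (u * (g\<^sup>2 / (1 - c)))"
    using c by (intro mult_left_mono) auto
  also have "\<dots> = g\<^sup>2" using c u by simp
  finally show ?thesis using g(3) by linarith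
qed

text \<open>Each step multiplies the excess over \<open>(1 + c) * energy \<Lambda>\<close> by at
  most \<open>1 - (1 - c) / u\<close>. After \<open>u\<close> steps the factor is at most
  \<open>exp (- (1 - c))\<close>, hence at most \<open>3 / 8\<close>.\<close>

lemma D_round:
  assumes L: "\<Lambda> \<subseteq> T" and u: "card (rest t - \<Lambda>) \<le> u" "u > 0"
    and n: "t + u + card T \<le> n" and c: "0 \<le> c" "c \<le> 0.009"
  shows "D (t + u) \<le> 3 / 8 * D t + 5 / 8 * ((1 + c) * energy \<Lambda>)"
proof -
  define B where "B = (1 + c) * energy \<Lambda>"
  define q where "q = 1 - (1 - c) / u"
  \<comment> \<open>Truncation at \<open>0\<close> keeps the bound valid once \<open>D\<close> has
    fallen below \<open>B\<close>.\<close>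
  define M where "M = max 0 (D t - B)"
  have q: "0 \<le> q" "q \<le> 1"
    using c u by (auto simp: q_def field_simps)
  have iter: "D (t + j) \<le> B + q ^ j * M" if "j \<le> u" for j
    using that
  proof (induction j)
    case 0
    then show ?case by (simp add: M_def)
  next
    case (Suc j)
    have IH: "D (t + j) \<le> B + q ^ j * M" using Suc by simp
    have pos: "0 \<le> q ^ Suc j * M" using q by (simp add: M_def)
    show ?case
    proof (cases "B \<le> D (t + j)")
      case True
      have "card (rest (t + j) - \<Lambda>) \<le> card (rest t - \<Lambda>)"
        using rest_antimono[of t "t + j"] by (intro card_mono) auto
      moreover have "card (S (t + j) \<union> T) \<le> n"
        using card_S_Un_T[of "t + j"] n Suc.prems by linarith
      ultimately have "D (Suc (t + j)) \<le> D (t + j) - (1 - c) / u * (D (t + j) - B)"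
        unfolding B_def using L u c by (intro D_Suc_le) auto
      also have "\<dots> = B + q * (D (t + j) - B)"
        by (simp add: q_def algebra_simps)
      also have "\<dots> \<le> B + q * (q ^ j * M)"
        using q IH by (intro add_left_mono mult_left_mono) auto
      finally show ?thesis by (simp add: mult_ac)
    next
      case False
      then show ?thesis using D_antimono[of "t + j" "Suc (t + j)"] pos by simp
    qed
  qed
  have "q ^ u \<le> exp (- (1 - c))"
    unfolding q_def using c u by (intro exp_ge_one_minus_x_over_n_power_n) auto
  also have "\<dots> \<le> exp (- 0.991)" using c by simp
  also have "\<dots> \<le> 3 / 8"
  proof -
    \<comment> \<open>\<open>0.24775\<close> is \<open>0.991 / 4\<close>: the fourth power of this
      quadratic Taylor bound exceeds \<open>8 / 3\<close>.\<close>
    have "1 + 0.24775 + 0.24775\<^sup>2 / 2 \<le> exp (0.24775 :: real)"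
      by (rule exp_lower_Taylor_quadratic) simp
    then have "(1 + 0.24775 + 0.24775\<^sup>2 / 2) ^ 4 \<le> exp (0.24775 :: real) ^ 4"
      by (intro power_mono) (auto simp: power2_eq_square)
    also have "\<dots> = exp 0.991" by (simp flip: exp_of_nat_mult)
    finally have "8 / 3 \<le> exp (0.991 :: real)" by (simp add: power4_eq_xxxx power2_eq_square)
    then show ?thesis by (simp add: exp_minus field_simps)
  qed
  finally have qu: "q ^ u \<le> 3 / 8" .
  show ?thesis
  proof (cases "B \<le> D t")
    case True
    have "D (t + u) \<le> B + q ^ u * (D t - B)" using iter[of u] True by (simp add: M_def)
    also have "\<dots> \<le> B + 3 / 8 * (D t - B)" using qu True by (intro add_left_mono mult_right_mono) auto
    finally show ?thesis unfolding B_def[symmetric] by (simp add: field_simps)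
  next
    case False
    then show ?thesis using D_antimono[of t "t + u"] unfolding B_def[symmetric] by simp
  qed
qed

end

section \<open>Recovery of the remaining support at a fixed cost per index\<close>

text \<open>Rounds are run until the tail of \<open>x\<close> first drops by a quarter. Up to that
  point \<open>D\<close> is at most \<open>5 / 4 * (1 + c)\<close> times the current tail. The drop
  pushes \<open>D\<close> below what \<open>m - u L\<close> unselected indices would force, so at
  least \<open>2 ^ L\<close> indices have been selected, in at most \<open>4 * 2 ^ L\<close>
  steps.\<close>

lemma rest_shrinks:
  assumes rip: "rip n c" and c: "0 \<le> c" "c \<le> 0.009"
    and ne: "rest t \<noteq> {}" and n: "t + 4 * card (rest t) + card T \<le> n"
  obtains s p where "p \<ge> 1" "s \<le> 4 * p" "card (rest (t + s)) + p \<le> card (rest t)"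
proof -
  define m where "m = card (rest t)"
  have m: "m > 0" using ne by (simp add: m_def card_gt_0_iff)
  define F where "F q = {\<Lambda>. \<Lambda> \<subseteq> rest t \<and> card \<Lambda> = m - q}" for q
  \<comment> \<open>The energy on \<open>rest t\<close> beyond its \<open>q\<close> largest entries,
    as a minimum over sets in place of a sorting.\<close>
  define tail where "tail q = Min (energy ` F q)" for q
  have fin: "finite (F q)" for q
    unfolding F_def by (rule finite_subset[of _ "Pow (rest t)"]) auto
  have "\<exists>\<Lambda>\<in>F q. energy \<Lambda> = tail q" for q
  proof -
    obtain \<Lambda> where "\<Lambda> \<subseteq> rest t" "card \<Lambda> = m - q"
      using obtain_subset_with_card_n[of "m - q" "rest t"] by (auto simp: m_def)
    then have "F q \<noteq> {}" by (auto simp: F_def)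
    then have "tail q \<in> energy ` F q"
      unfolding tail_def using fin by (intro Min_in) auto
    then show ?thesis by auto
  qed
  then obtain \<Lambda> where \<Lambda>: "\<And>q. \<Lambda> q \<in> F q" "\<And>q. energy (\<Lambda> q) = tail q"
    by metis
  have \<Lambda>_sub: "\<Lambda> q \<subseteq> rest t" "\<Lambda> q \<subseteq> T" and \<Lambda>_card: "card (\<Lambda> q) = m - q" for q
    using \<Lambda>(1)[of q] rest_subset(1)[of t] by (auto simp: F_def)
  have tail_le: "tail q \<le> energy A" if A: "A \<subseteq> rest t" "m - q \<le> card A" for A q
  proof -
    obtain B where B: "B \<subseteq> A" "card B = m - q"
      using obtain_subset_with_card_n[OF A(2)] by blast
    then have "tail q \<le> energy B"
      unfolding tail_def using fin A by (intro Min_le) (auto simp: F_def)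
    also have "\<dots> \<le> energy A"
      using A B rest_subset by (intro energy_mono) auto
    finally show ?thesis .
  qed
  have tail_nonneg: "0 \<le> tail q" for q
    using energy_nonneg[of "\<Lambda> q"] by (simp add: \<Lambda>)
  have tail_m: "tail m = 0"
  proof -
    have "\<Lambda> m = {}"
      using \<Lambda>_card[of m] \<Lambda>_sub[of m] finite_subset[OF _ finite_rest] by auto
    then show ?thesis using \<Lambda>(2)[of m] by (simp add: energy_def)
  qed
  have tail_pos: "0 < tail q" if "q < m" for q
  proof -
    have "\<Lambda> q \<noteq> {}" using \<Lambda>_card[of q] that by auto
    then show ?thesis using energy_pos[of "\<Lambda> q"] \<Lambda>_sub by (simp add: \<Lambda>)
  qed
  define u where "u l = min (2 ^ l - 1) m" for l :: nat
  define \<tau> where "\<tau> l = tail (u l)" for l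
  \<comment> \<open>The tail drops by at least a quarter. This happens for some index because the
    tails vanish once all \<open>m\<close> entries are covered.\<close>
  define P where "P l \<longleftrightarrow> 4 / 3 * \<tau> (Suc l) \<le> \<tau> l" for l
  define L where "L = (LEAST l. P l)"
  have "P m"
  proof -
    have "m \<le> 2 ^ m - 1" by (simp add: Suc_leI le_diff_conv2)
    moreover have "(2::nat) ^ m - 1 \<le> 2 ^ Suc m - 1" by simp
    ultimately have "u m = m" "u (Suc m) = m"
      unfolding u_def by linarith+
    then show ?thesis by (simp add: P_def \<tau>_def tail_m)
  qed
  then have PL: "P L" unfolding L_def by (rule LeastI)
  have not_P: "\<not> P l" if "l < L" for l
    using that unfolding L_def by (rule not_less_Least)
  \<comment> \<open>Otherwise the tail at \<open>L\<close> is \<open>0\<close>, so \<open>P\<close>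
    holds one index earlier; \<open>L = 0\<close> is excluded by \<open>u 0 = 0\<close>.\<close>
  have uL: "u L < m"
  proof (rule ccontr)
    assume "\<not> u L < m"
    then have uLm: "u L = m" by (simp add: u_def)
    then have "L \<noteq> 0" using m by (intro notI) (simp add: u_def)
    then obtain l where l: "L = Suc l" by (cases L) auto
    have "P l"
      unfolding P_def \<tau>_def l[symmetric] uLm tail_m using tail_nonneg by simp
    then show False using not_P l by simp
  qed
  then have uL_eq: "u L = 2 ^ L - 1" by (simp add: u_def)
  define s where "s l = (\<Sum>j<l. u (Suc j))" for l
  have s_le: "s l \<le> 2 ^ Suc l" for l
  proof -
    have "s l \<le> (\<Sum>j<l. 2 ^ Suc j)"
      unfolding s_def u_def by (intro sum_mono) auto
    also have "\<dots> + 2 = 2 ^ Suc l" by (induction l) auto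
    finally show ?thesis by simp
  qed
  have pow_L: "2 ^ L \<le> m" using uL uL_eq by simp
  have s_n: "t + s l + card T \<le> n" if "l \<le> Suc L" for l
  proof -
    have "s l \<le> 2 ^ Suc l" by (rule s_le)
    also have "\<dots> \<le> 2 ^ Suc (Suc L)" using that by (intro power_increasing) auto
    finally have "s l \<le> 4 * m" using pow_L by simp
    then show ?thesis using n by (simp add: m_def)
  qed
  have round: "D (t + s (Suc l)) \<le> 3 / 8 * D (t + s l) + 5 / 8 * ((1 + c) * \<tau> (Suc l))"
    if "l \<le> L" for l
  proof -
    let ?\<Lambda> = "\<Lambda> (u (Suc l))"
    have "card (rest (t + s l) - ?\<Lambda>) \<le> card (rest t - ?\<Lambda>)"
      using rest_antimono[of t "t + s l"] by (intro card_mono) auto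
    also have "\<dots> = u (Suc l)"
      using \<Lambda>_sub[of "u (Suc l)"] \<Lambda>_card[of "u (Suc l)"]
      by (simp add: card_Diff_subset finite_subset[OF _ finite_rest] m_def[symmetric]) (simp add: u_def)
    finally have "D (t + s l + u (Suc l)) \<le> 3 / 8 * D (t + s l) + 5 / 8 * ((1 + c) * energy ?\<Lambda>)"
      using c \<Lambda>_sub s_n[of "Suc l"] that m one_less_power[of "2::nat" "Suc l"]
      by (intro D_round[OF rip]) (simp_all add: s_def u_def)
    then show ?thesis by (simp add: s_def \<tau>_def \<Lambda> add.assoc)
  qed
  \<comment> \<open>\<open>5 / 4\<close> is a fixed point: without a drop,
    \<open>3 / 8 * (5 / 4) * (4 / 3) + 5 / 8 = 5 / 4\<close>.\<close>
  have bound: "D (t + s l) \<le> 5 / 4 * ((1 + c) * \<tau> l)" if "l \<le> L" for l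
    using that
  proof (induction l)
    case 0
    have "m \<le> n" using n by (simp add: m_def)
    then have "D t \<le> (1 + c) * energy (rest t)"
      by (intro D_upper[OF rip]) (simp add: m_def)
    also have "energy (rest t) = \<tau> 0"
    proof -
      have "\<Lambda> 0 = rest t"
        using \<Lambda>_sub[of 0] \<Lambda>_card[of 0] by (intro card_subset_eq) (auto simp: m_def)
      then show ?thesis using \<Lambda>(2)[of 0] by (simp add: \<tau>_def u_def)
    qed
    finally show ?case
      using mult_nonneg_nonneg[OF _ tail_nonneg[of "u 0"], of "1 + c"] c
      unfolding \<tau>_def[symmetric] by (simp add: s_def mult.commute)
  next
    case (Suc l)
    have "\<tau> l \<le> 4 / 3 * \<tau> (Suc l)"
      using not_P[of l] Suc.prems by (simp add: P_def)
    then have "(1 + c) * \<tau> l \<le> (1 + c) * (4 / 3 * \<tau> (Suc l))"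
      using c by (intro mult_left_mono) auto
    then show ?case
      using Suc round[of l] by (simp add: field_simps)
  qed
  let ?t = "t + s (Suc L)"
  have "(1 + c) * \<tau> (Suc L) \<le> (1 + c) * (3 / 4 * \<tau> L)"
    using PL c by (intro mult_left_mono) (auto simp: P_def)
  \<comment> \<open>\<open>3 / 8 * (5 / 4) + 5 / 8 * (3 / 4) = 15 / 16\<close>, which is below
    \<open>(1 - c) / (1 + c)\<close> for \<open>c \<le> 0.009\<close>.\<close>
  then have "D ?t \<le> 15 / 16 * ((1 + c) * \<tau> L)"
    using round[of L] bound[of L] by (simp add: field_simps)
  also have "\<dots> < (1 - c) * \<tau> L"
  proof -
    have "15 / 16 * (1 + c) * \<tau> L < (1 - c) * \<tau> L"
      using c tail_pos[OF uL] by (intro mult_strict_right_mono) (auto simp: \<tau>_def)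
    then show ?thesis by (simp add: mult_ac)
  qed
  finally have "D ?t < (1 - c) * \<tau> L" .
  moreover have "(1 - c) * energy (rest ?t) \<le> D ?t"
    using c card_S_Un_T[of ?t] s_n[of "Suc L"] by (intro D_lower[OF rip]) auto
  ultimately have "(1 - c) * energy (rest ?t) < (1 - c) * \<tau> L"
    by linarith
  then have "energy (rest ?t) < tail (u L)"
    using c by (simp add: \<tau>_def)
  then have "\<not> m - u L \<le> card (rest ?t)"
    using tail_le[of "rest ?t" "u L"] rest_antimono[of t ?t] by force
  then have "card (rest ?t) + 2 ^ L \<le> m"
    using uL uL_eq by simp
  moreover have "s (Suc L) \<le> 4 * 2 ^ L" using s_le[of "Suc L"] by simp
  ultimately show ?thesis
    by (intro that[of "2 ^ L" "s (Suc L)"]) (auto simp: m_def)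
qed

text \<open>Induction on the number of missing indices: selecting \<open>p\<close> of them costs at
  most \<open>4 * p\<close> steps, within the budget of \<open>6 * p\<close>.\<close>

lemma D_vanishes:
  assumes rip: "rip n c" and c: "0 \<le> c" "c \<le> 0.009"
    and n: "t + 6 * card (rest t) + card T \<le> n"
  shows "D (t + 6 * card (rest t)) = 0"
  using n
proof (induction "card (rest t)" arbitrary: t rule: less_induct)
  case less
  show ?case
  proof (cases "rest t = {}")
    case True
    have "D t \<le> (1 + c) * energy (rest t)"
      using True by (intro D_upper[OF rip]) auto
    then show ?thesis using True D_nonneg[of t] by (simp add: energy_def)
  next
    case False
    moreover have "t + 4 * card (rest t) + card T \<le> n" using less.prems by simp
    ultimately obtain s p where sp: "p \<ge> 1" "s \<le> 4 * p" "card (rest (t + s)) + p \<le> card (rest t)"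
      using rest_shrinks[OF rip c] by metis
    have le: "t + s + 6 * card (rest (t + s)) \<le> t + 6 * card (rest t)"
      using sp by linarith
    have "D (t + s + 6 * card (rest (t + s))) = 0"
      using sp le less.prems by (intro less.hyps) linarith+
    then show ?thesis
      using D_antimono[OF le] D_nonneg[of "t + 6 * card (rest t)"] by simp
  qed
qed

section \<open>Few wrong steps in the first phase\<close>

text \<open>Amortization: \<open>w\<close> is a price per unit of squared residual, raised to at
  least \<open>1 / g^2\<close> at each step, so every step pays for itself. The hypothesis
  \<open>big\<close> keeps \<open>g^2\<close> above \<open>10 / 3 * sqrt d\<close> and thereby the
  price below \<open>W\<close>; it comes from the case that the main theorem refutes.\<close>

lemma card_rest_le:
  assumes rip: "rip (2 * K) d" and d: "0 < d" "d < 0.001" and K: "card T \<le> K"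
    and x: "\<And>i. i < N \<Longrightarrow> \<bar>x i\<bar> \<le> 1"
    and big: "\<And>t. t < card T \<Longrightarrow> 10 * sqrt d * K < energy (rest t)"
  shows "card (rest (card T)) \<le> 10 * sqrt d * K"
proof -
  define k where "k = card T"
  define e where "e = sqrt d"
  have e: "0 < e" "e\<^sup>2 = d" using d by (auto simp: e_def)
  have e_small: "e \<le> 1 / 25"
  proof -
    have "e \<le> sqrt ((1 / 25)\<^sup>2)"
      unfolding e_def using d by (intro real_sqrt_le_mono) (auto simp: power2_eq_square)
    then show ?thesis by simp
  qed
  define W where "W = 3 / (10 * e)"
  have W: "W \<ge> 1" using e e_small by (simp add: W_def field_simps)
  have energy_le: "energy A \<le> card A" if "A \<subseteq> T" for A
  proof -
    have "energy A \<le> (\<Sum>i\<in>A. 1)"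
      unfolding energy_def
    proof (rule sum_mono)
      fix i assume "i \<in> A"
      then have "i < N" using that by (auto simp: T_def)
      then show "(x i)\<^sup>2 \<le> 1" using x by (simp add: abs_square_le_1)
    qed
    then show ?thesis by simp
  qed
  have card_rest: "card (rest t) \<le> k" for t
    unfolding k_def using rest_subset by (intro card_mono) auto
  have energy_K: "energy (rest t) \<le> K" for t
    using energy_le[OF rest_subset(1), of t] card_rest[of t] K by (simp add: k_def)
  have D_up: "D t \<le> (1 + d) * energy (rest t)" for t
    using card_rest[of t] K by (intro D_upper[OF rip]) (auto simp: k_def)
  have supp_le: "card (S t \<union> T) \<le> 2 * K" if "t \<le> k" for t
    using card_S_Un_T[of t] that K by (simp add: k_def)
  have D_low: "(1 - d) * energy (rest t) \<le> D t" if "t \<le> k" for t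
    using supp_le[OF that] d by (intro D_lower[OF rip]) auto
  \<comment> \<open>\<open>t + w * D t + pot w (rest t)\<close> starts near \<open>(1 + e) * k\<close> and hardly grows when \<open>w = 1 / min g\<^sup>2\<close>. It
    is at least about \<open>t + (1 + e) * card (rest t)\<close>, as \<open>w * D t\<close> is close to the sum of the \<open>w * x\<^sub>i\<^sup>2\<close>.\<close>
  define pot where "pot w A = (\<Sum>i\<in>A. max 0 (1 + e - w * (x i)\<^sup>2))" for w A
  have main: "\<exists>w. 1 \<le> w \<and> w \<le> W \<and>
      t + w * D t + pot w (rest t) \<le> (1 + e) * k + 19 * d * K * w" if "t \<le> k" for t
    using that
  proof (induction t)
    case 0
    have r0: "rest 0 = T" by (simp add: rest_def S_0)
    \<comment> \<open>At price \<open>1\<close> the truncation is inert as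
      \<open>(x i)^2 \<le> 1\<close>, and \<open>D 0\<close> cancels the energy up to
      \<open>d * K\<close>.\<close>
    have "pot 1 T = (\<Sum>i\<in>T. 1 + e - (x i)\<^sup>2)"
      unfolding pot_def
    proof (intro sum.cong refl)
      fix i assume "i \<in> T"
      then have "i < N" by (auto simp: T_def)
      then have "(x i)\<^sup>2 \<le> 1" using x by (simp add: abs_square_le_1)
      then show "max 0 (1 + e - 1 * (x i)\<^sup>2) = 1 + e - (x i)\<^sup>2" using e by simp
    qed
    also have "\<dots> = (1 + e) * k - energy T"
      by (simp add: sum_subtractf energy_def k_def mult.commute)
    finally have "pot 1 T = (1 + e) * k - energy T" .
    moreover have "D 0 \<le> energy T + d * energy T" using D_up[of 0] by (simp add: r0 algebra_simps)
    moreover have "d * energy T \<le> d * K"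
      using energy_K[of 0] d by (intro mult_left_mono) (auto simp: r0)
    moreover have "0 \<le> d * K" using d by simp
    ultimately show ?case
      using W by (intro exI[of _ 1]) (simp add: r0)
  next
    case (Suc t)
    then obtain w where w: "1 \<le> w" "w \<le> W"
      and IH: "t + w * D t + pot w (rest t) \<le> (1 + e) * k + 19 * d * K * w" by auto
    obtain g where g: "0 \<le> g" "\<And>i. i < N \<Longrightarrow> \<bar>corr (z t) i\<bar> \<le> g" "D (Suc t) \<le> D t - g\<^sup>2"
      using greedy[of t] by blast
    define s where "s = energy (rest t)"
    \<comment> \<open>The deviation of the correlations from \<open>x\<close> on the remaining
      support. Pairing it with \<open>z t\<close> reproduces \<open>nsq y\<close>, so polarization
      with \<open>l = 1 / d\<close> bounds it.\<close>
    define y where "y i = (if i \<in> rest t then corr (z t) i - x i else 0)" for i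
    have "nsq y \<le> d\<^sup>2 * nsq (z t)"
    proof -
      have "2 * (1 / d) * (form (z t) y - (\<Sum>i<N. z t i * y i)) \<le> d * (nsq (z t) + (1 / d)\<^sup>2 * nsq y)"
        using rip S_subset T_subset supp_le[of t] Suc.prems z_eq[of _ t] rest_subset(1)[of t]
        by (intro rip_polarization[where F = "S t \<union> T"]) (auto simp: y_def T_def)
      moreover have "form (z t) y - (\<Sum>i<N. z t i * y i) = nsq y"
      proof -
        have "form (z t) y = (\<Sum>i<N. y i * corr (z t) i)"
          by (subst form_sym) (simp add: form_def)
        then have "form (z t) y - (\<Sum>i<N. z t i * y i) = (\<Sum>i<N. y i * corr (z t) i - z t i * y i)"
          by (simp add: sum_subtractf)
        also have "\<dots> = nsq y"
          unfolding nsq_def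
          by (intro sum.cong refl) (auto simp: y_def z_eq rest_def power2_eq_square algebra_simps)
        finally show ?thesis .
      qed
      ultimately have "2 * (1 / d) * nsq y \<le> d * (nsq (z t) + (1 / d)\<^sup>2 * nsq y)" by simp
      then have "d * (2 * (1 / d) * nsq y) \<le> d * (d * (nsq (z t) + (1 / d)\<^sup>2 * nsq y))"
        using d by (intro mult_left_mono) auto
      then show ?thesis using d by (simp add: power2_eq_square field_simps)
    qed
    also have "nsq (z t) \<le> 2 * s"
    proof -
      have "(1 - d) * nsq (z t) \<le> (1 + d) * s"
        using D_lower_nsq[OF rip supp_le[of t]] D_up[of t] Suc.prems by (simp add: s_def)
      also have "\<dots> \<le> (1 - d) * (2 * s)"
        using d energy_nonneg[of "rest t"] mult_right_mono[of "1 + d" "(1 - d) * 2" s]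
        unfolding s_def[symmetric] by (simp only: mult.assoc) auto
      finally show ?thesis using d by simp
    qed
    finally have nsq_y: "nsq y \<le> 2 * d\<^sup>2 * s" using d by simp
    \<comment> \<open>The excess of an entry over \<open>g\<close>. Correlations are at most
      \<open>g\<close>, so \<open>y\<close> dominates it on the remaining support.\<close>
    define v where "v i = max 0 (\<bar>x i\<bar> - g)" for i
    have v: "(\<Sum>i\<in>rest t. (v i)\<^sup>2) \<le> 2 * d\<^sup>2 * s"
    proof -
      have "(\<Sum>i\<in>rest t. (v i)\<^sup>2) \<le> (\<Sum>i\<in>rest t. (y i)\<^sup>2)"
      proof (rule sum_mono)
        fix i assume i: "i \<in> rest t"
        then have "\<bar>corr (z t) i\<bar> \<le> g" using g(2) rest_subset(2) by blast
        then have "v i \<le> \<bar>y i\<bar>" using i by (auto simp: v_def y_def)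
        then show "(v i)\<^sup>2 \<le> (y i)\<^sup>2"
          by (intro abs_le_square_iff[THEN iffD1]) (auto simp: v_def)
      qed
      also have "\<dots> \<le> nsq y"
        unfolding nsq_def using rest_subset(2) by (intro sum_mono2) auto
      finally show ?thesis using nsq_y by simp
    qed
    have s_big: "10 * e * K < s"
      using big[of t] Suc.prems by (simp add: s_def e_def k_def)
    have s_pos: "0 < s"
      using s_big e by (intro le_less_trans[OF _ s_big]) auto
    \<comment> \<open>\<open>g\<close> cannot be small: the excesses carry little energy, so
      \<open>s\<close> is mostly covered by at most \<open>K\<close> contributions of
      \<open>2 * g^2\<close>.\<close>
    have "s \<le> 3 * K * g\<^sup>2"
    proof -
      have "s \<le> (\<Sum>i\<in>rest t. 2 * g\<^sup>2 + 2 * (v i)\<^sup>2)"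
        unfolding s_def energy_def
      proof (rule sum_mono)
        fix i
        have "\<bar>x i\<bar> \<le> g + v i" by (simp add: v_def)
        then have "(x i)\<^sup>2 \<le> (g + v i)\<^sup>2"
          using g(1) by (intro abs_le_square_iff[THEN iffD1]) auto
        also have "\<dots> \<le> 2 * g\<^sup>2 + 2 * (v i)\<^sup>2"
          using zero_le_power2[of "g - v i"] by (simp add: power2_eq_square algebra_simps)
        finally show "(x i)\<^sup>2 \<le> 2 * g\<^sup>2 + 2 * (v i)\<^sup>2" .
      qed
      also have "\<dots> = 2 * card (rest t) * g\<^sup>2 + 2 * (\<Sum>i\<in>rest t. (v i)\<^sup>2)"
        by (simp add: sum.distrib sum_distrib_left)
      also have "\<dots> \<le> 2 * K * g\<^sup>2 + 2 * (2 * d\<^sup>2 * s)"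
        using v card_rest[of t] K by (intro add_mono mult_right_mono mult_left_mono) (auto simp: k_def)
      also have "2 * (2 * d\<^sup>2 * s) \<le> s / 3"
      proof -
        have "d\<^sup>2 \<le> 0.001\<^sup>2" using d by (intro power_mono) auto
        then have "d\<^sup>2 * s \<le> 1 / 12 * s" using s_pos by (intro mult_right_mono) (auto simp: power2_eq_square)
        then show ?thesis by simp
      qed
      finally show ?thesis by simp
    qed
    with s_big have gK: "10 * e * K < 3 * K * g\<^sup>2" by simp
    then have "K > 0" by (cases "K = 0") auto
    then have g_big: "10 * e < 3 * g\<^sup>2" using gK by (simp add: mult.commute[of _ "real K"] mult.assoc[symmetric])
    then have g2: "g\<^sup>2 > 0" using e by linarith
    define w' where "w' = max w (1 / g\<^sup>2)"
    have "1 / g\<^sup>2 \<le> W" unfolding W_def using g_big g2 e by (simp add: field_simps)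
    then have w'W: "1 \<le> w'" "w' \<le> W" "w \<le> w'" using w by (auto simp: w'_def)
    have w'g: "1 \<le> w' * g\<^sup>2"
      using mult_right_mono[of "1 / g\<^sup>2" w' "g\<^sup>2"] g2 by (simp add: w'_def)
    \<comment> \<open>Raising the price to \<open>w'\<close> lowers an untruncated term by
      \<open>(w' - w) * (x i)^2\<close>. A term truncated at \<open>w'\<close> belongs to an entry
      well above \<open>g\<close>, and what it fails to contribute is charged to
      \<open>v i\<close>.\<close>
    have pot_change: "pot w' (rest t) \<le> pot w (rest t) - (w' - w) * (s - 18 * d * s)"
    proof (cases "w' = w")
      case False
      then have w'_eq: "w' * g\<^sup>2 = 1" using g2 by (auto simp: w'_def max_def split: if_splits)
      have pt: "(w' - w) * ((x i)\<^sup>2 - 9 / d * (v i)\<^sup>2)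
          \<le> max 0 (1 + e - w * (x i)\<^sup>2) - max 0 (1 + e - w' * (x i)\<^sup>2)" for i
      proof (cases "w' * (x i)\<^sup>2 \<le> 1 + e")
        case True
        then have "w * (x i)\<^sup>2 \<le> 1 + e"
          using w'W by (intro order.trans[OF mult_right_mono True]) auto
        moreover have "0 \<le> (w' - w) * (9 / d * (v i)\<^sup>2)" using w'W d by simp
        ultimately show ?thesis using True by (simp add: algebra_simps)
      next
        case big_x: False
        \<comment> \<open>Here \<open>w' * g^2 = 1\<close> and \<open>w' * (x i)^2 > 1 + e\<close>.
          Since \<open>(1 - e / 3)^2 * (1 + e) \<ge> 1\<close>, the entry exceeds \<open>g\<close>
          by at least \<open>e / 3\<close> of its size.\<close>
        have "e * \<bar>x i\<bar> \<le> 3 * v i"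
        proof (rule ccontr)
          assume "\<not> e * \<bar>x i\<bar> \<le> 3 * v i"
          then have less: "3 * v i < e * \<bar>x i\<bar>" by simp
          have "\<bar>x i\<bar> - g \<le> v i" by (simp add: v_def)
          then have "3 * (\<bar>x i\<bar> - g) \<le> 3 * v i" by simp
          also note less
          finally have "3 * (\<bar>x i\<bar> - g) < e * \<bar>x i\<bar>" .
          then have less: "(1 - e / 3) * \<bar>x i\<bar> < g" by (simp add: algebra_simps)
          then have "((1 - e / 3) * \<bar>x i\<bar>)\<^sup>2 < g\<^sup>2"
            using e_small by (intro power_strict_mono) auto
          then have "w' * ((1 - e / 3) * \<bar>x i\<bar>)\<^sup>2 < 1"
            using w'_eq w'W mult_strict_left_mono[of "((1 - e / 3) * \<bar>x i\<bar>)\<^sup>2" "g\<^sup>2" w'] by simp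
          then have "(1 - e / 3)\<^sup>2 * (w' * (x i)\<^sup>2) < 1"
            by (simp add: power_mult_distrib mult_ac)
          moreover have "(1 - e / 3)\<^sup>2 * (1 + e) \<le> (1 - e / 3)\<^sup>2 * (w' * (x i)\<^sup>2)"
            using big_x by (intro mult_left_mono) auto
          moreover have "1 \<le> (1 - e / 3)\<^sup>2 * (1 + e)"
          proof -
            have "(1 - e / 3)\<^sup>2 * (1 + e) = 1 + e * (1 / 3 - 5 / 9 * e + e\<^sup>2 / 9)"
              by (simp add: power2_eq_square field_simps)
            moreover have "0 \<le> e * (1 / 3 - 5 / 9 * e + e\<^sup>2 / 9)"
              using e e_small by (intro mult_nonneg_nonneg) (auto intro: add_nonneg_nonneg)
            ultimately show ?thesis by simp
          qed
          ultimately show False by linarith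
        qed
        then have "(e * \<bar>x i\<bar>)\<^sup>2 \<le> (3 * v i)\<^sup>2" using e by (intro power_mono) auto
        then have "d * (x i)\<^sup>2 \<le> 9 * (v i)\<^sup>2" by (simp add: power_mult_distrib e)
        then have "(x i)\<^sup>2 - 9 / d * (v i)\<^sup>2 \<le> 0" using d by (simp add: field_simps)
        then have "(w' - w) * ((x i)\<^sup>2 - 9 / d * (v i)\<^sup>2) \<le> 0"
          using w'W by (intro mult_nonneg_nonpos) auto
        then show ?thesis using big_x by simp
      qed
      have "(w' - w) * (s - 18 * d * s) \<le> (w' - w) * (s - 9 / d * (\<Sum>i\<in>rest t. (v i)\<^sup>2))"
      proof -
        have "9 / d * (\<Sum>i\<in>rest t. (v i)\<^sup>2) \<le> 9 / d * (2 * d\<^sup>2 * s)"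
          using d v by (intro mult_left_mono) auto
        also have "\<dots> = 18 * d * s" using d by (simp add: power2_eq_square)
        finally show ?thesis using w'W by (intro mult_left_mono) auto
      qed
      also have "\<dots> = (\<Sum>i\<in>rest t. (w' - w) * ((x i)\<^sup>2 - 9 / d * (v i)\<^sup>2))"
        by (simp only: s_def energy_def sum_distrib_left sum_subtractf right_diff_distrib)
      also have "\<dots> \<le> pot w (rest t) - pot w' (rest t)"
        unfolding pot_def sum_subtractf[symmetric] by (intro sum_mono pt)
      finally show ?thesis by simp
    qed simp
    \<comment> \<open>At price \<open>w'\<close> the drop of \<open>D\<close> is worth at least
      \<open>1\<close>, the cost of the step.\<close>
    have "real (Suc t) + w' * D (Suc t) + pot w' (rest (Suc t)) \<le> t + w' * D t + pot w' (rest t)"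
    proof -
      have "w' * D (Suc t) \<le> w' * (D t - g\<^sup>2)"
        using g(3) w'W by (intro mult_left_mono) auto
      moreover have "pot w' (rest (Suc t)) \<le> pot w' (rest t)"
        unfolding pot_def using rest_antimono[of t "Suc t"] by (intro sum_mono2) auto
      ultimately show ?thesis using w'g by (simp add: right_diff_distrib)
    qed
    \<comment> \<open>Per unit of price, at most \<open>s + d * s\<close> is charged for
      \<open>D t\<close> and \<open>pot_change\<close> returns \<open>s - 18 * d * s\<close>; the
      growth is the difference \<open>19 * d * s\<close>.\<close>
    also have "\<dots> \<le> t + w * D t + pot w (rest t) + (w' - w) * (19 * d * K)"
    proof -
      have "(w' - w) * (D t - (s - 18 * d * s)) \<le> (w' - w) * (19 * d * K)"
      proof (intro mult_left_mono)
        have "D t \<le> s + d * s" using D_up[of t] by (simp add: s_def algebra_simps)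
        moreover have "d * s \<le> d * K" using energy_K[of t] d by (simp add: s_def)
        ultimately show "D t - (s - 18 * d * s) \<le> 19 * d * K" by simp
      qed (use w'W in simp)
      then show ?thesis using pot_change by (simp add: algebra_simps)
    qed
    also have "\<dots> \<le> (1 + e) * k + 19 * d * K * w'"
      using IH by (simp add: algebra_simps)
    finally show ?case using w'W by blast
  qed
  then obtain w where w: "1 \<le> w" "w \<le> W"
    and fin: "k + w * D k + pot w (rest k) \<le> (1 + e) * k + 19 * d * K * w" by auto
  define r where "r = card (rest k)"
  have "(\<Sum>i\<in>rest k. 1 + e - w * (x i)\<^sup>2) \<le> pot w (rest k)"
    unfolding pot_def by (intro sum_mono) auto
  then have "(1 + e) * r - w * energy (rest k) \<le> pot w (rest k)"
    by (simp add: sum_subtractf energy_def sum_distrib_left r_def mult.commute)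
  moreover have "w * energy (rest k) - w * D k \<le> w * (d * K)"
  proof -
    have "energy (rest k) - D k \<le> d * energy (rest k)" using D_low[of k] by (simp add: algebra_simps)
    also have "\<dots> \<le> d * K" using energy_K[of k] d by simp
    finally show ?thesis
      using w mult_left_mono[of "energy (rest k) - D k" "d * K" w] by (simp add: right_diff_distrib)
  qed
  \<comment> \<open>The lower RIP bound adds one more \<open>d * K * w\<close> to the
    \<open>19\<close>. With \<open>w \<le> W\<close> the right side becomes at most
    \<open>e * K + 6 * e * K\<close>.\<close>
  ultimately have "(1 + e) * r \<le> e * k + 20 * d * K * w"
    using fin by (simp add: algebra_simps)
  moreover have "r \<le> (1 + e) * r" using e by (simp add: algebra_simps)
  moreover have "e * k \<le> e * K" using e K by (simp add: k_def)
  moreover have "20 * d * K * w \<le> 20 * d * K * W"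
    using w d by (intro mult_left_mono) auto
  moreover have "20 * d * K * W = 6 * e * K"
    using e by (simp add: W_def power2_eq_square flip: e(2))
  ultimately have "r \<le> 7 * (e * K)" by linarith
  also have "\<dots> \<le> 10 * (e * K)" using e by simp
  finally show ?thesis by (simp add: r_def k_def e_def mult_ac)
qed

end

section \<open>Vectors and their coefficients\<close>

definition synth :: "nat \<Rightarrow> nat \<Rightarrow> (nat \<Rightarrow> real vec) \<Rightarrow> (nat \<Rightarrow> real) \<Rightarrow> real vec" where
  "synth M N \<phi> y = dict_mat M N \<phi> *\<^sub>v vec N y"

lemma synth_carrier [simp]: "synth M N \<phi> y \<in> carrier_vec M"
  by (rule carrier_vecI) (simp add: synth_def dict_mat_def)

lemma dim_synth [simp]: "dim_vec (synth M N \<phi> y) = M"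
  by (simp add: synth_def dict_mat_def)

lemma synth_index: "k < M \<Longrightarrow> synth M N \<phi> y $ k = (\<Sum>i<N. y i * \<phi> i $ k)"
  by (simp add: synth_def dict_mat_def scalar_prod_def mat_of_cols_def lessThan_atLeast0 mult.commute
      cong: sum.cong_simp)

lemma scalar_prod_synth:
  assumes "\<And>i. i < N \<Longrightarrow> \<phi> i \<in> carrier_vec M" "v \<in> carrier_vec M"
  shows "v \<bullet> synth M N \<phi> y = (\<Sum>i<N. y i * (v \<bullet> \<phi> i))"
proof -
  have "v \<bullet> synth M N \<phi> y = (\<Sum>k<M. \<Sum>i<N. y i * (v $ k * \<phi> i $ k))"
    by (simp add: scalar_prod_def synth_index sum_distrib_left mult_ac flip: lessThan_atLeast0)
  also have "\<dots> = (\<Sum>i<N. \<Sum>k<M. y i * (v $ k * \<phi> i $ k))"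
    by (rule sum.swap)
  also have "\<dots> = (\<Sum>i<N. y i * (v \<bullet> \<phi> i))"
    using assms by (intro sum.cong refl)
      (auto simp: scalar_prod_def sum_distrib_left lessThan_atLeast0 carrier_vecD[OF assms(1)])
  finally show ?thesis .
qed

lemma synth_add: "synth M N \<phi> (\<lambda>i. y i + l * w i) = synth M N \<phi> y + l \<cdot>\<^sub>v synth M N \<phi> w"
  by (intro eq_vecI) (simp_all add: synth_index algebra_simps sum.distrib sum_distrib_left)

lemma synth_unit:
  assumes "i < N" "\<phi> i \<in> carrier_vec M"
  shows "synth M N \<phi> (\<lambda>j. if j = i then 1 else 0) = \<phi> i"
  using assms(1) carrier_vecD[OF assms(2)]
  by (intro eq_vecI) (auto simp: synth_index if_distrib[of "\<lambda>x. x * _"] cong: if_cong)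

text \<open>Turns projections onto a span into coefficient vectors. Coefficients belong to indices
  and not to vectors, so equal dictionary elements do no harm.\<close>

lemma vspan_eq_synth:
  assumes \<phi>: "\<And>i. i < N \<Longrightarrow> \<phi> i \<in> carrier_vec M" and A: "A \<subseteq> {..<N}"
  shows "vspan M (\<phi> ` A) = {synth M N \<phi> y |y. \<forall>i<N. i \<notin> A \<longrightarrow> y i = 0}" (is "_ = ?R")
proof -
  interpret V: vec_space "TYPE(real)" M .
  have W: "\<phi> ` A \<subseteq> carrier_vec M" using A \<phi> by auto
  have zero: "synth M N \<phi> (\<lambda>i. 0) = 0\<^sub>v M"
    by (intro eq_vecI) (auto simp: synth_index)
  have "submodule class_ring ?R (module_vec TYPE(real) M)"
  proof (unfold_locales)
    show "?R \<subseteq> carrier (module_vec TYPE(real) M)" by (auto simp: module_vec_simps)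
    show "\<zero>\<^bsub>module_vec TYPE(real) M\<^esub> \<in> ?R"
      using zero by (auto simp: module_vec_simps intro!: exI[of _ "\<lambda>_. 0"])
    show "v \<oplus>\<^bsub>module_vec TYPE(real) M\<^esub> w \<in> ?R" if vw: "v \<in> ?R" "w \<in> ?R" for v w
    proof -
      obtain y y' where "v = synth M N \<phi> y" "w = synth M N \<phi> y'"
        "\<forall>i<N. i \<notin> A \<longrightarrow> y i = 0" "\<forall>i<N. i \<notin> A \<longrightarrow> y' i = 0" using vw by auto
      then show ?thesis
        using synth_add[of M N \<phi> y 1 y'] by (auto simp: module_vec_simps intro!: exI[of _ "\<lambda>i. y i + y' i"])
    qed
    show "l \<odot>\<^bsub>module_vec TYPE(real) M\<^esub> v \<in> ?R" if v: "l \<in> carrier class_ring" "v \<in> ?R" for l v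
    proof -
      obtain y where "v = synth M N \<phi> y" "\<forall>i<N. i \<notin> A \<longrightarrow> y i = 0" using v by auto
      then show ?thesis
        using synth_add[of M N \<phi> "\<lambda>_. 0" l y]
        by (auto simp: module_vec_simps zero intro!: exI[of _ "\<lambda>i. l * y i"])
    qed
  qed
  moreover have "\<phi> ` A \<subseteq> ?R"
  proof
    fix v assume "v \<in> \<phi> ` A"
    then obtain i where i: "i \<in> A" "v = \<phi> i" by auto
    then have "v = synth M N \<phi> (\<lambda>j. if j = i then 1 else 0)" using A \<phi> by (subst synth_unit) auto
    then show "v \<in> ?R" using i by (auto intro!: exI[of _ "\<lambda>j. if j = i then 1 else 0"])
  qed
  ultimately have "vspan M (\<phi> ` A) \<subseteq> ?R" by (rule V.span_is_subset[rotated])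
  moreover have "synth M N \<phi> y \<in> vspan M (\<phi> ` A)" if "\<forall>i<N. i \<notin> A \<longrightarrow> y i = 0" for y
  proof -
    have "synth M N \<phi> (\<lambda>i. if i \<in> B then y i else 0) \<in> vspan M (\<phi> ` A)" if "finite B" "B \<subseteq> A" for B
      using that
    proof (induction B rule: finite_induct)
      case empty
      then show ?case using V.span_zero by (simp add: zero)
    next
      case (insert j B)
      have j: "j \<in> A" "j < N" using insert A by auto
      have "synth M N \<phi> (\<lambda>i. if i \<in> insert j B then y i else 0)
        = synth M N \<phi> (\<lambda>i. (if i \<in> B then y i else 0) + y j * (if i = j then 1 else 0))"
        using insert by (intro arg_cong[of _ _ "synth M N \<phi>"]) auto
      also have "\<dots> = synth M N \<phi> (\<lambda>i. if i \<in> B then y i else 0) + y j \<cdot>\<^sub>v \<phi> j"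
        using j \<phi> by (subst synth_add) (simp add: synth_unit)
      also have "\<dots> \<in> vspan M (\<phi> ` A)"
      proof (rule V.span_add1[OF W])
        show "synth M N \<phi> (\<lambda>i. if i \<in> B then y i else 0) \<in> vspan M (\<phi> ` A)"
          using insert by simp
        show "y j \<cdot>\<^sub>v \<phi> j \<in> vspan M (\<phi> ` A)"
          using j W by (intro V.smult_in_span V.span_mem) auto
      qed
      finally show ?case .
    qed
    from this[of A] A finite_subset
    have "synth M N \<phi> (\<lambda>i. if i \<in> A then y i else 0) \<in> vspan M (\<phi> ` A)" by blast
    moreover have "synth M N \<phi> (\<lambda>i. if i \<in> A then y i else 0) = synth M N \<phi> y"
      using that by (intro eq_vecI) (auto simp: synth_index intro!: sum.cong)
    ultimately show ?thesis by simp
  qed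
  ultimately show ?thesis by auto
qed

section \<open>Restrictions, supports and the count of small entries\<close>

lemma vnorm_sq: "(vnorm v)\<^sup>2 = v \<bullet> v"
  by (simp add: vnorm_def scalar_prod_def sum_nonneg)

lemma vnorm_restr_sq:
  assumes "\<Lambda> \<subseteq> supp x"
  shows "(vnorm (restr x \<Lambda>))\<^sup>2 = (\<Sum>i\<in>\<Lambda>. (x $ i)\<^sup>2)"
proof -
  have "(vnorm (restr x \<Lambda>))\<^sup>2 = (\<Sum>i<dim_vec x. if i \<in> \<Lambda> then (x $ i)\<^sup>2 else 0)"
    unfolding vnorm_sq scalar_prod_def restr_def
    by (intro sum.cong) (auto simp: power2_eq_square lessThan_atLeast0)
  also have "\<dots> = (\<Sum>i\<in>\<Lambda>. (x $ i)\<^sup>2)"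
    using assms by (intro sum.mono_neutral_cong_right) (auto simp: supp_def)
  finally show ?thesis .
qed

lemma finite_supp [simp]: "finite (supp x)"
  by (simp add: supp_def)

lemma N_count_less:
  assumes "\<Lambda> \<subseteq> supp x" "N_count x \<nu> < card \<Lambda>"
  shows "\<nu> < (vnorm (restr x \<Lambda>))\<^sup>2"
proof -
  let ?P = "\<lambda>n. \<forall>\<Lambda>\<subseteq>supp x. n + 1 \<le> card \<Lambda> \<longrightarrow> \<nu> < (vnorm (restr x \<Lambda>))\<^sup>2"
  have "?P (card (supp x))"
  proof (intro allI impI)
    fix \<Lambda> assume "\<Lambda> \<subseteq> supp x" "card (supp x) + 1 \<le> card \<Lambda>"
    then show "\<nu> < (vnorm (restr x \<Lambda>))\<^sup>2"
      using card_mono[of "supp x" \<Lambda>] by simp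
  qed
  then have "?P (N_count x \<nu>)"
    unfolding N_count_def by (rule LeastI)
  then show ?thesis using assms by simp
qed

text \<open>A set of \<open>m\<close> entries bounded by \<open>1\<close> has energy at most
  \<open>m\<close>, which does not exceed \<nu>; so the count cannot be smaller than
  \<open>m\<close>.\<close>

lemma le_N_count:
  assumes "\<And>i. i < dim_vec x \<Longrightarrow> \<bar>x $ i\<bar> \<le> 1" "m \<le> card (supp x)" "real m \<le> \<nu>"
  shows "m \<le> N_count x \<nu>"
proof (rule ccontr)
  assume "\<not> m \<le> N_count x \<nu>"
  obtain \<Lambda> where \<Lambda>: "\<Lambda> \<subseteq> supp x" "card \<Lambda> = m"
    using obtain_subset_with_card_n[OF assms(2)] by blast
  have "\<nu> < (\<Sum>i\<in>\<Lambda>. (x $ i)\<^sup>2)"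
    using N_count_less[of \<Lambda> x \<nu>] \<Lambda> \<open>\<not> m \<le> _\<close> by (simp add: vnorm_restr_sq)
  also have "\<dots> \<le> (\<Sum>i\<in>\<Lambda>. 1)"
  proof (rule sum_mono)
    fix i assume "i \<in> \<Lambda>"
    then have "i < dim_vec x" using \<Lambda> by (auto simp: supp_def)
    then show "(x $ i)\<^sup>2 \<le> 1" using assms(1) by (simp add: abs_square_le_1)
  qed
  finally show False using \<Lambda> assms(3) by simp
qed

lemma sup_norm_le:
  assumes "sup_norm x \<le> b" "i < dim_vec x"
  shows "\<bar>x $ i\<bar> \<le> b"
proof -
  have "\<bar>x $ i\<bar> \<le> sup_norm x"
    unfolding sup_norm_def using assms(2) by (intro Max_ge) auto
  then show ?thesis using assms(1) by simp
qed

section \<open>From the dictionary and its OMP runs to the coefficient locales\<close>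

lemma gram_form_scalar_prod:
  assumes "\<And>i. i < N \<Longrightarrow> \<phi> i \<in> carrier_vec M"
  shows "gram_form N (\<lambda>i j. \<phi> i \<bullet> \<phi> j)"
proof
  show "\<phi> i \<bullet> \<phi> j = \<phi> j \<bullet> \<phi> i" if "i < N" "j < N" for i j
    using that assms by (intro comm_scalar_prod) auto
  show "0 \<le> (\<Sum>i<N. \<Sum>j<N. y i * (\<phi> i \<bullet> \<phi> j * y j))" for y
  proof -
    have "0 \<le> synth M N \<phi> y \<bullet> synth M N \<phi> y"
      by (simp add: scalar_prod_def sum_nonneg)
    also have "\<dots> = (\<Sum>i<N. y i * (\<phi> i \<bullet> synth M N \<phi> y))"
      using assms by (subst scalar_prod_synth) (auto intro!: sum.cong comm_scalar_prod[of _ M])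
    also have "\<dots> = (\<Sum>i<N. \<Sum>j<N. y i * (\<phi> i \<bullet> \<phi> j * y j))"
      using assms by (intro sum.cong refl) (simp add: scalar_prod_synth sum_distrib_left mult_ac)
    finally show ?thesis .
  qed
qed

locale vector_system =
  fixes M N :: nat and \<phi> :: "nat \<Rightarrow> real vec"
  assumes carrier: "i < N \<Longrightarrow> \<phi> i \<in> carrier_vec M"
begin

sublocale gram_form N "\<lambda>i j. \<phi> i \<bullet> \<phi> j"
  using carrier by (rule gram_form_scalar_prod)

lemma corr_eq: "i < N \<Longrightarrow> corr y i = \<phi> i \<bullet> synth M N \<phi> y"
  using carrier by (simp add: corr_def scalar_prod_synth mult.commute)

lemma form_eq: "form y w = synth M N \<phi> y \<bullet> synth M N \<phi> w"
proof -
  have "form y w = (\<Sum>i<N. y i * (synth M N \<phi> w \<bullet> \<phi> i))"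
    unfolding form_def using carrier
    by (intro sum.cong refl) (auto simp: corr_eq intro!: comm_scalar_prod[of _ M])
  also have "\<dots> = synth M N \<phi> w \<bullet> synth M N \<phi> y"
    using carrier by (simp add: scalar_prod_synth)
  also have "\<dots> = synth M N \<phi> y \<bullet> synth M N \<phi> w"
    by (rule comm_scalar_prod[of _ M]) auto
  finally show ?thesis .
qed

text \<open>The right side is the predicate under \<open>LEAST\<close> in \<open>rip_const\<close>,
  so \<open>rip_Least\<close> transfers by rewriting.\<close>

lemma rip_iff:
  "rip s d \<longleftrightarrow> (\<forall>x \<in> carrier_vec N. sparse s x \<longrightarrow>
     (1 - d) * (vnorm x)\<^sup>2 \<le> (vnorm (dict_mat M N \<phi> *\<^sub>v x))\<^sup>2 \<and>
     (vnorm (dict_mat M N \<phi> *\<^sub>v x))\<^sup>2 \<le> (1 + d) * (vnorm x)\<^sup>2)"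
    (is "_ \<longleftrightarrow> (\<forall>x \<in> _. ?P x)")
proof -
  have supp: "supp (vec N y) = {i. i < N \<and> y i \<noteq> 0}" for y
    by (auto simp: supp_def)
  have nsq: "(vnorm (vec N y))\<^sup>2 = nsq y" for y
    unfolding vnorm_sq by (simp add: nsq_def scalar_prod_def power2_eq_square lessThan_atLeast0)
  have frm: "(vnorm (dict_mat M N \<phi> *\<^sub>v vec N y))\<^sup>2 = form y y" for y
    by (simp add: vnorm_sq form_eq synth_def)
  have "rip s d \<longleftrightarrow> (\<forall>y. ?P (vec N y))"
    unfolding rip_def sparse_def supp nsq frm by (auto simp: abs_le_iff algebra_simps)
  also have "\<dots> \<longleftrightarrow> (\<forall>x \<in> carrier_vec N. ?P x)"
  proof
    assume P: "\<forall>y. ?P (vec N y)"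
    show "\<forall>x \<in> carrier_vec N. ?P x"
    proof
      fix x :: "real vec" assume "x \<in> carrier_vec N"
      then have "vec N (($) x) = x" by (intro eq_vecI) auto
      then show "?P x" using P by metis
    qed
  qed auto
  finally show ?thesis .
qed

lemma rip_rip_const:
  assumes "0 < s" "0 < N"
  shows "rip s (rip_const s M N \<phi>)"
  using rip_Least[OF assms] unfolding rip_const_def rip_iff[symmetric] .

text \<open>A projection subtracts a combination of selected elements, which leaves coefficients
  outside \<open>S t\<close> untouched; orthogonality to the span makes the correlations on
  \<open>S t\<close> zero. The decrease follows by comparison with a single correction of the old
  residual along the chosen element.\<close>

lemma omp_coefficients_exist:
  assumes unit: "\<And>i. i < N \<Longrightarrow> vnorm (\<phi> i) = 1" and "x \<in> carrier_vec N"
    and omp: "omp M (\<phi> ` {..<N}) (dict_mat M N \<phi> *\<^sub>v x) \<psi> r"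
  obtains z S where "omp_coefficients N (\<lambda>i j. \<phi> i \<bullet> \<phi> j) (($) x) z S"
    "\<And>t. r t = synth M N \<phi> (z t)"
proof -
  let ?x = "($) x"
  let ?syn = "synth M N \<phi>"
  have f0: "dict_mat M N \<phi> *\<^sub>v x = ?syn ?x"
  proof -
    have "vec N ?x = x" using \<open>x \<in> carrier_vec N\<close> by (intro eq_vecI) auto
    then show ?thesis by (simp add: synth_def)
  qed
  have r0: "r 0 = ?syn ?x" using omp by (simp add: omp_def f0)
  have step: "\<psi> m \<in> \<phi> ` {..<N}" "\<bar>r (m - 1) \<bullet> \<psi> m\<bar> = (SUP g\<in>\<phi> ` {..<N}. \<bar>r (m - 1) \<bullet> g\<bar>)"
    "\<exists>G. is_orth_proj M (vspan M (\<psi> ` {1..m})) (?syn ?x) G \<and> r m = ?syn ?x - G" if "m \<ge> 1" for m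
    using omp that unfolding omp_def f0 by blast+
  have "\<forall>m\<in>{1..}. \<exists>i. i < N \<and> \<psi> m = \<phi> i" using step(1) by auto
  then obtain \<iota> where \<iota>: "\<And>m. m \<ge> 1 \<Longrightarrow> \<iota> m < N" "\<And>m. m \<ge> 1 \<Longrightarrow> \<psi> m = \<phi> (\<iota> m)"
    by (metis atLeast_iff)
  define S where "S t = \<iota> ` {1..t}" for t
  have S_sub: "S t \<subseteq> {..<N}" for t using \<iota> by (auto simp: S_def)
  have "\<exists>w. (\<forall>i<N. i \<notin> S t \<longrightarrow> w i = ?x i) \<and> r t = ?syn w \<and> (\<forall>i\<in>S t. corr w i = 0)" for t
  proof (cases "t = 0")
    case True
    then show ?thesis using r0 by (auto simp: S_def)
  next
    case False
    have img: "\<psi> ` {1..t} = \<phi> ` S t"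
      unfolding S_def image_image using \<iota> by (intro image_cong) auto
    have span: "vspan M (\<phi> ` S t) = {?syn y |y. \<forall>i<N. i \<notin> S t \<longrightarrow> y i = 0}"
      using carrier S_sub by (rule vspan_eq_synth)
    obtain G where G: "G \<in> vspan M (\<phi> ` S t)" "\<And>v. v \<in> vspan M (\<phi> ` S t) \<Longrightarrow> (?syn ?x - G) \<bullet> v = 0"
      "r t = ?syn ?x - G"
      using step(3)[of t] False unfolding is_orth_proj_def img by auto
    obtain y where y: "G = ?syn y" "\<forall>i<N. i \<notin> S t \<longrightarrow> y i = 0" using G(1) unfolding span by auto
    let ?w = "\<lambda>i. ?x i + (-1) * y i"
    have rt: "r t = ?syn ?w"
      unfolding G(3) y(1) by (subst synth_add) auto
    have "corr ?w i = 0" if i: "i \<in> S t" for i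
    proof -
      have "i < N" using i S_sub by auto
      have "\<phi> i = ?syn (\<lambda>j. if j = i then 1 else 0)"
        using carrier \<open>i < N\<close> by (simp add: synth_unit)
      then have "\<phi> i \<in> vspan M (\<phi> ` S t)"
        unfolding span using i by (auto intro!: exI[of _ "\<lambda>j. if j = i then 1 else 0"])
      then have "r t \<bullet> \<phi> i = 0" using G by simp
      then show ?thesis
        using carrier \<open>i < N\<close> by (simp add: corr_eq rt comm_scalar_prod[of "\<phi> i" M])
    qed
    then show ?thesis using rt y(2) by (intro exI[of _ ?w]) auto
  qed
  then obtain z where z: "\<And>t i. i < N \<Longrightarrow> i \<notin> S t \<Longrightarrow> z t i = ?x i" "\<And>t. r t = ?syn (z t)"
    "\<And>t i. i \<in> S t \<Longrightarrow> corr (z t) i = 0"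
    by metis
  have "omp_coefficients N (\<lambda>i j. \<phi> i \<bullet> \<phi> j) ?x z S"
  proof (unfold_locales)
    show "S 0 = {}" by (simp add: S_def)
    show "S t \<subseteq> S (Suc t)" for t unfolding S_def by (intro image_mono) auto
    show "S t \<subseteq> {..<N}" for t by (rule S_sub)
    show "card (S t) \<le> t" for t unfolding S_def using card_image_le[of "{1..t}" \<iota>] by simp
    show "z t i = ?x i" if "i < N" "i \<notin> S t" for i t using z(1) that .
    show "corr (z t) i = 0" if "i \<in> S t" for i t using z(3) that .
    show "form (z (Suc t)) (z (Suc t)) \<le> form (z t) (z t) - (corr (z t) i)\<^sup>2" if "i < N" for t i
    proof -
      define j where "j = \<iota> (Suc t)"
      have j: "j < N" "j \<in> S (Suc t)" "\<psi> (Suc t) = \<phi> j" using \<iota> by (auto simp: j_def S_def)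
      have corr_r: "corr (z t) l = r t \<bullet> \<phi> l" if "l < N" for l
        using carrier that by (simp add: corr_eq z(2) comm_scalar_prod[of "\<phi> l" M])
      have "\<bar>r t \<bullet> \<phi> i\<bar> \<le> (SUP g\<in>\<phi> ` {..<N}. \<bar>r t \<bullet> g\<bar>)"
        using that by (intro cSUP_upper bdd_above_finite) auto
      also have "\<dots> = \<bar>r t \<bullet> \<phi> j\<bar>" using step(2)[of "Suc t"] j by simp
      finally have le: "(corr (z t) i)\<^sup>2 \<le> (corr (z t) j)\<^sup>2"
        using that j by (simp add: corr_r abs_le_square_iff)
      let ?e = "\<lambda>l. if l = j then 1 else 0 :: real"
      \<comment> \<open>Removes from the old residual its component along the chosen unit vector;
        the squared norm drops by exactly the largest squared correlation.\<close>
      let ?w = "\<lambda>l. z t l + (- corr (z t) j) * ?e l"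
      have "form (z (Suc t)) (z (Suc t)) \<le> form ?w ?w"
      proof (rule form_le_if_orthogonal)
        fix l assume "l < N" "?w l \<noteq> z (Suc t) l"
        moreover have "S t \<subseteq> S (Suc t)" unfolding S_def by (intro image_mono) auto
        ultimately have "l \<in> S (Suc t)"
          using z(1)[of l t] z(1)[of l "Suc t"] j(2)
          by (cases "l \<in> S (Suc t)") (auto split: if_splits)
        then show "corr (z (Suc t)) l = 0" by (rule z(3))
      qed
      also have "form ?w ?w = form (z t) (z t) - (corr (z t) j)\<^sup>2"
      proof -
        have "form ?e (z t) = corr (z t) j"
          using j by (simp add: form_def if_distrib[of "\<lambda>x. x * _"] cong: if_cong)
        moreover have "form ?e ?e = 1"
        proof -
          have "form ?e ?e = \<phi> j \<bullet> \<phi> j" using carrier j by (simp add: form_eq synth_unit)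
          also have "\<dots> = 1" using unit[OF j(1)] by (simp flip: vnorm_sq)
          finally show ?thesis .
        qed
        ultimately show ?thesis
          unfolding form_add by (simp add: form_sym[of "z t" ?e] power2_eq_square)
      qed
      finally show ?thesis using le by linarith
    qed
  qed
  then show ?thesis using z(2) that by blast
qed

end

section \<open>Both phases combined\<close>

theorem theorem2p1:
  shows "\<exists>C::real. C > 0 \<and>
    (\<forall>\<delta>::real. 0 < \<delta> \<and> \<delta> < 0.001 \<longrightarrow>
      (\<exists>K\<^sub>0::nat. \<forall>K\<ge>K\<^sub>0. \<forall>M N \<phi>.
        dictionary M N \<phi> \<and> rip_const (2 * K) M N \<phi> < \<delta> \<longrightarrow>
        (\<forall>x \<in> carrier_vec N. sparse K x \<and> sup_norm x \<le> 1 \<longrightarrow>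
          (\<forall>\<psi> r. omp M (\<phi> ` {..<N}) (dict_mat M N \<phi> *\<^sub>v x) \<psi> r \<longrightarrow>
            r (K + 6 * N_count x (C * sqrt \<delta> * real K)) = 0\<^sub>v M))))"
proof -
  have "r (K + 6 * N_count x (10 * sqrt \<delta> * real K)) = 0\<^sub>v M"
    if \<delta>: "0 < \<delta>" "\<delta> < 0.001" and K: "1 \<le> K" and dict: "dictionary M N \<phi>"
      and rip_const: "rip_const (2 * K) M N \<phi> < \<delta>"
      and x: "x \<in> carrier_vec N" "sparse K x" "sup_norm x \<le> 1"
      and omp: "omp M (\<phi> ` {..<N}) (dict_mat M N \<phi> *\<^sub>v x) \<psi> r"
    for \<delta> :: real and K M N :: nat and \<phi> x \<psi> r
  proof -
    define \<nu> where "\<nu> = 10 * sqrt \<delta> * real K"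
    interpret vector_system M N \<phi>
      using dict by unfold_locales (auto simp: dictionary_def)
    obtain z S where "omp_coefficients N (\<lambda>i j. \<phi> i \<bullet> \<phi> j) (($) x) z S"
      and r: "\<And>t. r t = synth M N \<phi> (z t)"
      using omp_coefficients_exist[OF _ x(1) omp] dict by (auto simp: dictionary_def)
    then interpret omp_coefficients N "\<lambda>i j. \<phi> i \<bullet> \<phi> j" "($) x" z S by blast
    have "rip (2 * K) (rip_const (2 * K) M N \<phi>)"
      using K dict by (intro rip_rip_const) (auto simp: dictionary_def)
    then have rip: "rip (2 * K) \<delta>"
      by (rule rip_mono) (use rip_const in simp)
    \<comment> \<open>The second phase involves at most
      \<open>k + 6 * card (rest k) + card T \<le> 8 * K\<close> indices, and
      \<open>8 * \<delta> < 0.008\<close> respects the limit \<open>0.009\<close> of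
      \<open>D_vanishes\<close>.\<close>
    then have rip8: "rip (8 * K) (8 * \<delta>)"
      using K rip_mult[of K \<delta> 8] by simp
    have T: "T = supp x" using x(1) by (auto simp: T_def supp_def)
    have cT: "card T \<le> K" using x(2) by (simp add: T sparse_def)
    have x1: "\<bar>x $ i\<bar> \<le> 1" if "i < N" for i
      using sup_norm_le[OF x(3)] x(1) that by auto
    define k where "k = card T"
    have rest_k: "card (rest k) \<le> N_count x \<nu>"
    proof (rule ccontr)
      assume neg: "\<not> card (rest k) \<le> N_count x \<nu>"
      \<comment> \<open>Up to step \<open>k\<close> the remaining support is at least as large as
        \<open>rest k\<close>, hence larger than the count, and so has energy above \<nu>. This is
        the hypothesis \<open>big\<close> of \<open>card_rest_le\<close>, whose conclusion then
        contradicts \<open>le_N_count\<close>.\<close>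
      have "\<nu> < energy (rest t)" if "t < card T" for t
      proof -
        have "card (rest k) \<le> card (rest t)"
          using that by (intro card_mono rest_antimono) (auto simp: k_def)
        then have "\<nu> < (vnorm (restr x (rest t)))\<^sup>2"
          using neg rest_subset(1)[of t] by (intro N_count_less) (auto simp: T)
        then show ?thesis
          using rest_subset(1)[of t] by (simp add: vnorm_restr_sq energy_def T)
      qed
      then have "card (rest k) \<le> \<nu>"
        unfolding \<nu>_def k_def using rip \<delta> cT x1 by (intro card_rest_le) auto
      moreover have "card (rest k) \<le> card (supp x)"
        using rest_subset(1)[of k] by (intro card_mono) (auto simp: T)
      ultimately show False
        using neg le_N_count[of x "card (rest k)" \<nu>] x1 x(1) by auto
    qed
    have "card (rest k) \<le> K"
      using card_mono[OF finite_T rest_subset(1)[of k]] cT by simp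
    then have "D (k + 6 * card (rest k)) = 0"
      using \<delta> cT by (intro D_vanishes[OF rip8]) (auto simp: k_def)
    moreover have "D (K + 6 * N_count x \<nu>) \<le> D (k + 6 * card (rest k))"
      using rest_k cT by (intro D_antimono) (simp add: k_def)
    ultimately have "D (K + 6 * N_count x \<nu>) = 0"
      using D_nonneg[of "K + 6 * N_count x \<nu>"] by simp
    then have "r (K + 6 * N_count x \<nu>) \<bullet> r (K + 6 * N_count x \<nu>) = 0"
      by (simp add: D_def form_eq r)
    then have "r (K + 6 * N_count x \<nu>) = 0\<^sub>v M"
      by (intro eq_vecI) (auto simp: r scalar_prod_def sum_nonneg_eq_0_iff)
    then show ?thesis by (simp only: \<nu>_def)
  qed
  then show ?thesis
    \<comment> \<open>\<open>K\<^sub>0 = 1\<close> serves every \<delta>: \<open>K \<ge> 1\<close>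
      makes the minimum in \<open>rip_const\<close> exist and the blocks in \<open>rip_mult\<close>
      nonempty.\<close>
    by (intro exI[of _ "10::real"] conjI allI impI exI[of _ "1::nat"]) auto
qed

end
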